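(* Let $1\le p\le\infty$, $K\in\mathcal{N}(l^p(\mathbb{Z}))$ and $Z=\Delta_p+K$ on $l^p(\mathbb{Z})$. Let $\{\lambda_k\}_{k\in\mathbb{N}}\subseteq\sigma_{disc}(Z)$ be a sequence converging to some $\lambda_0\in[-2,2]$. Restricting the sequence to a subsequence, one can consider the following cases: (i.a) $\lambda_0=-2$ and $\operatorname{Re}(\lambda_k)\le-2$; (i.b) $\lambda_0=2$ and $\operatorname{Re}(\lambda_k)\ge2$; (ii.a) $\lambda_0=-2$ and $\operatorname{Re}(\lambda_k)>-2$; (ii.b) $\lambda_0=2$ and $\operatorname{Re}(\lambda_k)<2$; (iii) $\lambda_0\in(-2,2)$. Then for $\tau>0$: in case (i.a), $$\sum_{k=1}^\infty|\lambda_k+2|^{2+\tau}<\infty;$$ in case (ii.a), $$\sum_{k=1}^\infty\frac{|\operatorname{Im}(\lambda_k)|^{3+\tau}}{|\lambda_k+2|}<\infty;$$ and in case (iii), $$\sum_{k=1}^\infty|\operatorname{Im}(\lambda_k)|^{3+\tau}<\infty.$$ By symmetry, cases (i.b) and (ii.b) are covered by the statements for (i.a) and (ii.a), respectively, with $\lambda_k+2$ replaced by $\lambda_k-2$.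
   Context: $l^p(\mathbb{Z})$ is the complex Banach space of $p$-summable (for $p=\infty$: bounded) complex sequences indexed by $\mathbb{Z}$. The discrete Laplacian $\Delta_p:l^p(\mathbb{Z})\to l^p(\mathbb{Z})$ is the bounded operator $(\Delta_p f)(n)=f(n-1)+f(n+1)$; its spectrum is purely essential and equals $[-2,2]$. Nuclear operators: for a complex Banach space $X$ with dual $X^*$, a compact operator $K\in\mathcal{B}(X)$ (the bounded linear operators on $X$) is nuclear, $K\in\mathcal{N}(X)$, if there are sequences $(f_n)\subseteq X$, $(\phi_n)\subseteq X^*$ with $Kf=\sum_{n=1}^\infty\langle\phi_n,f\rangle f_n$ for all $f\in X$ and $\sum_{n=1}^\infty\|\phi_n\|_{X^*}\|f_n\|_X<\infty$. Discrete spectrum: $\sigma_{disc}(Z)$ is the set of eigenvalues of $Z$ which are isolated points of the spectrum $\sigma(Z)$ and whose Riesz projection has finite rank.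
   Formalization: The sequence of the λ_k is assumed to consist of pairwise distinct points of the discrete spectrum; if eigenvalues could be repeated finitely often at will, the sums could be made to diverge. *)

theory Defs
  imports
    "HOL-Complex_Analysis.Complex_Analysis"
    "HOL-Library.Function_Algebras"
begin

text \<open>
  Since the exponent \<open>p\<close> is a variable, \<open>l\<^sup>p(\<int>)\<close> is a subset of the type of all two-sided complex
  sequences, and operators and functionals are total functions of which only the restriction to this
  subset matters. The pointwise \<open>+\<close>, \<open>-\<close>, \<open>0\<close> and finite sums of sequences (and of operators) are those
  of \<^theory>\<open>HOL-Library.Function_Algebras\<close>.
\<close>

type_synonym bisequence = "int \<Rightarrow> complex"

definition scale :: "complex \<Rightarrow> bisequence \<Rightarrow> bisequence"  (infixr "*\<^sub>C" 75) where
  "c *\<^sub>C f = (\<lambda>n. c * f n)"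

definition lp :: "ennreal \<Rightarrow> bisequence set" where
  "lp p = (if p = \<infinity> then {f. bounded (range f)}
           else {f. (\<lambda>n. cmod (f n) powr enn2real p) summable_on UNIV})"

definition lp_norm :: "ennreal \<Rightarrow> bisequence \<Rightarrow> real" where
  "lp_norm p f = (if p = \<infinity> then (SUP n. cmod (f n))
                  else (\<Sum>\<^sub>\<infinity>n. cmod (f n) powr enn2real p) powr (1 / enn2real p))"

definition bounded_op :: "ennreal \<Rightarrow> (bisequence \<Rightarrow> bisequence) \<Rightarrow> bool" where
  "bounded_op p T \<longleftrightarrow>
     (\<forall>f\<in>lp p. T f \<in> lp p) \<and>
     (\<forall>f\<in>lp p. \<forall>g\<in>lp p. T (f + g) = T f + T g) \<and>
     (\<forall>c. \<forall>f\<in>lp p. T (c *\<^sub>C f) = c *\<^sub>C T f) \<and>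
     (\<exists>C. \<forall>f\<in>lp p. lp_norm p (T f) \<le> C * lp_norm p f)"

definition dual :: "ennreal \<Rightarrow> (bisequence \<Rightarrow> complex) set" where
  "dual p = {\<phi>.
     (\<forall>f\<in>lp p. \<forall>g\<in>lp p. \<phi> (f + g) = \<phi> f + \<phi> g) \<and>
     (\<forall>c. \<forall>f\<in>lp p. \<phi> (c *\<^sub>C f) = c * \<phi> f) \<and>
     (\<exists>C. \<forall>f\<in>lp p. cmod (\<phi> f) \<le> C * lp_norm p f)}"

definition dual_norm :: "ennreal \<Rightarrow> (bisequence \<Rightarrow> complex) \<Rightarrow> real" where
  "dual_norm p \<phi> = (SUP f\<in>{f \<in> lp p. lp_norm p f \<le> 1}. cmod (\<phi> f))"

definition compact_op :: "ennreal \<Rightarrow> (bisequence \<Rightarrow> bisequence) \<Rightarrow> bool" where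
  "compact_op p T \<longleftrightarrow> bounded_op p T \<and>
     (\<forall>f :: nat \<Rightarrow> bisequence. (\<forall>k. f k \<in> lp p) \<and> (\<exists>C. \<forall>k. lp_norm p (f k) \<le> C) \<longrightarrow>
       (\<exists>r g. strict_mono r \<and> g \<in> lp p \<and> (\<lambda>k. lp_norm p (T (f (r k)) - g)) \<longlonglongrightarrow> 0))"

definition nuclear_op :: "ennreal \<Rightarrow> (bisequence \<Rightarrow> bisequence) \<Rightarrow> bool" where
  "nuclear_op p K \<longleftrightarrow> compact_op p K \<and>
     (\<exists>(f :: nat \<Rightarrow> bisequence) (\<phi> :: nat \<Rightarrow> bisequence \<Rightarrow> complex).
       (\<forall>n. f n \<in> lp p) \<and> (\<forall>n. \<phi> n \<in> dual p) \<and>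
       (\<forall>g\<in>lp p. (\<lambda>N. lp_norm p (K g - (\<Sum>n<N. \<phi> n g *\<^sub>C f n))) \<longlonglongrightarrow> 0) \<and>
       summable (\<lambda>n. dual_norm p (\<phi> n) * lp_norm p (f n)))"

definition laplacian :: "bisequence \<Rightarrow> bisequence" where
  "laplacian f = (\<lambda>n. f (n - 1) + f (n + 1))"

definition spectrum :: "ennreal \<Rightarrow> (bisequence \<Rightarrow> bisequence) \<Rightarrow> complex set" where
  "spectrum p T = {z. \<not> (\<exists>R. bounded_op p R \<and>
     (\<forall>f\<in>lp p. R (z *\<^sub>C f - T f) = f \<and> z *\<^sub>C R f - T (R f) = f))}"

definition eigenvalue :: "ennreal \<Rightarrow> (bisequence \<Rightarrow> bisequence) \<Rightarrow> complex \<Rightarrow> bool" where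
  "eigenvalue p T z \<longleftrightarrow> (\<exists>f\<in>lp p. f \<noteq> 0 \<and> T f = z *\<^sub>C f)"

text \<open>Meaningful for \<open>z \<notin> spectrum p T\<close>, where it is \<open>(z - T)\<^sup>-\<^sup>1 f\<close>.\<close>

definition resolvent :: "ennreal \<Rightarrow> (bisequence \<Rightarrow> bisequence) \<Rightarrow> complex \<Rightarrow> bisequence \<Rightarrow> bisequence" where
  "resolvent p T z f = (THE g. g \<in> lp p \<and> z *\<^sub>C g - T g = f)"

text \<open>
  \<open>P = 1/(2\<pi>\<i>) \<integral> (w - T)\<^sup>-\<^sup>1 dw\<close> over a positively oriented circle around \<open>z\<close> that, together with its
  interior, meets the spectrum at most in \<open>z\<close>. As usual for vector-valued integrals, the integral
  is the vector whose image under every bounded functional is the integral of the images.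
\<close>

definition riesz_projection ::
    "ennreal \<Rightarrow> (bisequence \<Rightarrow> bisequence) \<Rightarrow> complex \<Rightarrow> (bisequence \<Rightarrow> bisequence) \<Rightarrow> bool" where
  "riesz_projection p T z P \<longleftrightarrow> bounded_op p P \<and>
     (\<exists>r>0. cball z r \<inter> spectrum p T \<subseteq> {z} \<and>
       (\<forall>f\<in>lp p. \<forall>\<phi>\<in>dual p.
         \<phi> (P f) = contour_integral (circlepath z r) (\<lambda>w. \<phi> (resolvent p T w f))
                     / (2 * complex_of_real pi * \<i>)))"

definition finite_rank :: "ennreal \<Rightarrow> (bisequence \<Rightarrow> bisequence) \<Rightarrow> bool" where
  "finite_rank p P \<longleftrightarrow>
     (\<exists>B. finite B \<and> (\<forall>f\<in>lp p. \<exists>c. P f = (\<Sum>b\<in>B. c b *\<^sub>C b)))"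

definition discrete_spectrum :: "ennreal \<Rightarrow> (bisequence \<Rightarrow> bisequence) \<Rightarrow> complex set" where
  "discrete_spectrum p T = {z. eigenvalue p T z \<and> z isolated_in spectrum p T \<and>
     (\<exists>P. riesz_projection p T z P \<and> finite_rank p P)}"

definition case_ia :: "real \<Rightarrow> (nat \<Rightarrow> complex) \<Rightarrow> bool" where
  "case_ia l \<mu> \<longleftrightarrow> l = -2 \<and> (\<forall>k. Re (\<mu> k) \<le> -2)"

definition case_ib :: "real \<Rightarrow> (nat \<Rightarrow> complex) \<Rightarrow> bool" where
  "case_ib l \<mu> \<longleftrightarrow> l = 2 \<and> (\<forall>k. Re (\<mu> k) \<ge> 2)"

definition case_iia :: "real \<Rightarrow> (nat \<Rightarrow> complex) \<Rightarrow> bool" where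
  "case_iia l \<mu> \<longleftrightarrow> l = -2 \<and> (\<forall>k. Re (\<mu> k) > -2)"

definition case_iib :: "real \<Rightarrow> (nat \<Rightarrow> complex) \<Rightarrow> bool" where
  "case_iib l \<mu> \<longleftrightarrow> l = 2 \<and> (\<forall>k. Re (\<mu> k) < 2)"

definition case_iii :: "real \<Rightarrow> (nat \<Rightarrow> complex) \<Rightarrow> bool" where
  "case_iii l \<mu> \<longleftrightarrow> -2 < l \<and> l < 2"

end

theory Submission
  imports Defs "Jordan_Normal_Form.Determinant"
begin

text \<open>
  Write \<open>\<lambda> = w + 1/w\<close> with \<open>0 < |w| < 1\<close>; then \<open>(\<lambda> - \<Delta>)\<^sup>-\<^sup>1\<close> is convolution with
  \<open>w\<^bsup>|n|\<^esup> w / (1 - w\<^sup>2)\<close>. For \<open>K = \<Sum> \<phi>\<^sub>n \<otimes> f\<^sub>n\<close>, normalised so that \<open>\<phi>\<^sub>n\<close> and \<open>f\<^sub>n\<close> have norm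
  at most \<open>s\<^sub>n\<close> with \<open>\<Sum> s\<^sub>n\<^sup>2 < \<infinity>\<close>, an eigenvector \<open>g\<close> yields a null vector \<open>(\<phi>\<^sub>n g)\<^sub>n\<close> of
  \<open>1 - A(w)\<close>, \<open>A\<^sub>m\<^sub>n(w) = \<phi>\<^sub>m ((\<lambda> - \<Delta>)\<^sup>-\<^sup>1 f\<^sub>n)\<close>. Hadamard's inequality bounds the finite sections of
  \<open>det (1 - A(w))\<close> by \<open>exp (C / ((1 - |w|)\<^sup>2 |1 - w\<^sup>2|\<^sup>2))\<close>, so by Montel's theorem they have a
  holomorphic limit point \<open>D\<close> with the same bound, and \<open>D(0) = 1\<close>. Cramer's rule shows that \<open>D\<close>
  vanishes at the eigenvalues.

  The product \<open>D(w) D(-w)\<close> is a function of \<open>q = w\<^sup>2\<close> whose growth has the single exceptional boundary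
  point \<open>q = 1\<close>. Dividing out Blaschke factors of the disc \<open>|q| < 1 - \<delta>\<close> with a neighbourhood of
  \<open>1\<close> of size \<open>s\<close> removed shows that at most \<open>O(1 / (\<delta>\<^sup>3 s))\<close> zeros satisfy \<open>1 - |q| \<ge> \<delta>\<close>
  and \<open>|1 - q| \<ge> s\<close>; a dyadic summation over \<open>\<delta>\<close> and \<open>s\<close> gives the theorem.
\<close>

section \<open>A Blaschke-type bound on the number of zeros\<close>

text \<open>
  In the coordinate \<open>u = (\<rho> - x) / (\<rho> + x)\<close>, which maps \<open>|x| < \<rho>\<close> to the right half-plane, the map
  \<open>v = u - s\<^sup>2 / u\<close> sends \<open>{Re u > 0, |u| > s}\<close> conformally onto the right half-plane. The Blaschke
  factor of the zero \<open>q\<close> is \<open>(v - v\<^sub>q) / (v + cnj v\<^sub>q)\<close>; with denominators cleared, its modulus is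
  the quotient of the two sides of \<open>blaschke_boundary\<close>.
\<close>

lemma blaschke_second_factor:
  fixes P M p m :: complex and s :: real
  assumes "Re (P * cnj M) = 0"
  shows "cmod (P * p + s\<^sup>2 * M * m) = cmod (P * cnj p - s\<^sup>2 * M * cnj m)"
proof -
  have "(cmod (P * p + complex_of_real \<sigma> * M * m))\<^sup>2 - (cmod (P * cnj p - complex_of_real \<sigma> * M * cnj m))\<^sup>2
      = 4 * \<sigma> * Re (P * cnj M) * Re (p * cnj m)" for \<sigma>
    by (simp add: cmod_power2) (simp add: power2_eq_square algebra_simps)
  from this[of "s\<^sup>2"] show ?thesis
    unfolding assms by (simp only: mult_zero_right mult_zero_left right_minus_eq power2_eq_iff_nonneg norm_ge_zero of_real_power)
qed

text \<open>On the arc \<open>cmod P = s * cmod M\<close> one has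
  \<open>cnj P * P = s\<^sup>2 * (cnj M * M)\<close>. Multiplying the second factor of either side
  by \<open>cnj P\<close> therefore yields \<open>s\<^sup>2 * M\<close> times the conjugate of the
  first factor of the other side, up to sign, so the factors match crosswise.\<close>

lemma blaschke_swap:
  fixes P M p m :: complex and s :: real
  assumes "cmod P = s * cmod M" "s > 0"
  shows "cmod (P * m - p * M) * cmod (P * p + s\<^sup>2 * M * m)
       = cmod (P * cnj m + cnj p * M) * cmod (P * cnj p - s\<^sup>2 * M * cnj m)"
proof (cases "M = 0")
  case True
  then show ?thesis using assms by simp
next
  case False
  have PP: "cnj P * P = s\<^sup>2 * (cnj M * M)"
    using assms(1) by (metis complex_norm_square mult.commute of_real_mult power_mult_distrib)
  have "cnj P * (P * cnj p - s\<^sup>2 * M * cnj m) = s\<^sup>2 * M * cnj (M * p - P * m)"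
    by (simp add: right_diff_distrib mult.assoc[symmetric] PP)
  then have "cmod P * cmod (P * cnj p - s\<^sup>2 * M * cnj m) = s\<^sup>2 * cmod M * cmod (M * p - P * m)"
    by (metis complex_mod_cnj norm_mult norm_of_real abs_power2 of_real_power)
  then have 1: "cmod (P * cnj p - s\<^sup>2 * M * cnj m) = s * cmod (P * m - p * M)"
    using False assms by (simp add: power2_eq_square norm_minus_commute mult.commute)
  have "cnj P * (P * p + s\<^sup>2 * M * m) = s\<^sup>2 * M * cnj (M * cnj p + P * cnj m)"
    by (simp add: distrib_left mult.assoc[symmetric] PP)
  then have "cmod P * cmod (P * p + s\<^sup>2 * M * m) = s\<^sup>2 * cmod M * cmod (M * cnj p + P * cnj m)"
    by (metis complex_mod_cnj norm_mult norm_of_real abs_power2 of_real_power)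
  then have 2: "cmod (P * p + s\<^sup>2 * M * m) = s * cmod (P * cnj m + cnj p * M)"
    using False assms by (simp add: power2_eq_square add.commute mult.commute)
  show ?thesis
    unfolding 1 2 by (simp only: mult_ac)
qed

text \<open>The boundary has two pieces. On the circle \<open>cmod x = \<rho>\<close> the first
  factors agree and so do the second ones; on the arc |u| = s the factors agree crosswise by
  \<open>blaschke_swap\<close>.\<close>

lemma blaschke_boundary:
  fixes x q :: complex and \<rho> s :: real
  assumes "s > 0" "\<rho> > 0"
    and "cmod x = \<rho> \<or> cmod (\<rho> - x) = s * cmod (\<rho> + x)"
  shows "\<rho> * cmod (x - q) * cmod ((\<rho> - x) * (\<rho> - q) + s\<^sup>2 * (\<rho> + x) * (\<rho> + q))
       = cmod (\<rho>\<^sup>2 - x * cnj q) * cmod ((\<rho> - x) * (\<rho> - cnj q) - s\<^sup>2 * (\<rho> + x) * (\<rho> + cnj q))"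
  using assms(3)
proof
  assume *: "cmod x = \<rho>"
  then have r: "complex_of_real (\<rho>\<^sup>2) = x * cnj x"
    using complex_norm_square by metis
  have "Re ((\<rho> - x) * cnj (\<rho> + x)) = \<rho>\<^sup>2 - (cmod x)\<^sup>2"
    by (simp add: cmod_power2) (simp add: power2_eq_square algebra_simps)
  then have 1: "Re ((\<rho> - x) * cnj (\<rho> + x)) = 0" using * by simp
  have "\<rho>\<^sup>2 - x * cnj q = x * cnj (x - q)"
    using r by (simp add: algebra_simps)
  then have "cmod (\<rho>\<^sup>2 - x * cnj q) = \<rho> * cmod (x - q)"
    using * by (metis complex_mod_cnj norm_mult)
  then show ?thesis
    using blaschke_second_factor[OF 1, of "\<rho> - q" s "\<rho> + q"] by simp
next
  assume *: "cmod (\<rho> - x) = s * cmod (\<rho> + x)"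
  have e: "(\<rho> - x) * (\<rho> + q) - (\<rho> - q) * (\<rho> + x) = (2 * \<rho>) * (q - x)"
    "(\<rho> - x) * (\<rho> + cnj q) + (\<rho> - cnj q) * (\<rho> + x) = 2 * (\<rho>\<^sup>2 - x * cnj q)"
    by (simp_all add: algebra_simps power2_eq_square)
  have "cmod (2 * \<rho> * (q - x)) = 2 * (\<rho> * cmod (x - q))" 
    "cmod (2 * (\<rho>\<^sup>2 - x * cnj q)) = 2 * cmod (\<rho>\<^sup>2 - x * cnj q)"
    using assms(2) by (simp_all only: norm_mult norm_minus_commute[of q] norm_of_real norm_numeral abs_of_pos mult.assoc)
  then show ?thesis
    using blaschke_swap[OF * assms(1), of "\<rho> + q" "\<rho> - q"] e by simp
qed

text \<open>For the full disc the Blaschke factor at 0 would have modulus |q| / \<rho>. Removing the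
  neighbourhood of \<rho> multiplies this by the quotient of the two norms, \<open>A / E\<close> in
  the proof. Since \<open>A\<^sup>2\<close> exceeds \<open>E\<^sup>2\<close> only by 4 s^2 (\<rho>^2
  - |q|^2) and \<open>q\<close> stays at distance 4 s from \<rho>, this costs at most half of the
  relative gain 1 - |q|^2 / \<rho>^2.\<close>

lemma blaschke_at_zero:
  fixes q :: complex and \<rho> s \<delta> :: real
  assumes "0 < s" "s \<le> 1/2" "1/2 \<le> \<rho>" "\<rho> < 1" "cmod q \<le> \<rho> - \<delta>" "0 < \<delta>" "4 * s \<le> cmod (\<rho> - q)"
  shows "cmod q * exp (\<delta> / 4) * cmod ((\<rho> - q) + s\<^sup>2 * (\<rho> + q))
     \<le> \<rho> * cmod ((\<rho> - cnj q) - s\<^sup>2 * (\<rho> + cnj q))"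
proof -
  define E where "E = cmod ((\<rho> - q) - s\<^sup>2 * (\<rho> + q))"
  define A where "A = cmod ((\<rho> - q) + s\<^sup>2 * (\<rho> + q))"
  have E': "cmod ((\<rho> - cnj q) - s\<^sup>2 * (\<rho> + cnj q)) = E"
    unfolding E_def by (metis (no_types, opaque_lifting) complex_cnj_add complex_cnj_complex_of_real
        complex_cnj_diff complex_cnj_mult complex_mod_cnj)
  define y where "y = (cmod q)\<^sup>2 / \<rho>\<^sup>2"
  have q2: "(cmod q)\<^sup>2 = y * \<rho>\<^sup>2" using assms unfolding y_def by simp
  have AE: "A\<^sup>2 = E\<^sup>2 + 4 * s\<^sup>2 * (\<rho>\<^sup>2 - (cmod q)\<^sup>2)"
    unfolding A_def E_def
    by (simp add: cmod_power2 flip: of_real_power) (simp add: power2_eq_square algebra_simps)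
  have "cmod (\<rho> + q) \<le> 2"
    using norm_triangle_ineq[of "complex_of_real \<rho>" q] assms by simp
  then have "cmod (s\<^sup>2 * (\<rho> + q)) \<le> s\<^sup>2 * 2"
    by (simp add: norm_mult norm_power mult_left_mono)
  also have "\<dots> \<le> s" using assms by (simp add: power2_eq_square)
  finally have "3 * s \<le> E"
    using norm_triangle_ineq2[of "\<rho> - q" "s\<^sup>2 * (\<rho> + q)"] assms(7) unfolding E_def by linarith
  then have "9 * s\<^sup>2 \<le> E\<^sup>2"
    using power_mono[of "3 * s" E 2] assms by (simp add: power_mult_distrib)
  moreover have "\<rho>\<^sup>2 \<le> 1" using assms by (simp add: power_le_one)
  then have "s\<^sup>2 * \<rho>\<^sup>2 \<le> s\<^sup>2 * 1" by (intro mult_left_mono) auto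
  ultimately have sE: "8 * (s\<^sup>2 * \<rho>\<^sup>2) \<le> E\<^sup>2"
    by (smt (verit) zero_le_power2)
  have q\<rho>: "cmod q \<le> \<rho>" using assms by linarith
  have y01: "0 \<le> y" "y \<le> 1"
    using assms q\<rho> unfolding y_def by (auto simp: divide_simps power_mono)
  have "(1 - y) * (8 * (s\<^sup>2 * \<rho>\<^sup>2)) \<le> (1 - y) * E\<^sup>2"
    using sE y01 by (intro mult_left_mono) auto
  moreover have "4 * s\<^sup>2 * (\<rho>\<^sup>2 - (cmod q)\<^sup>2) = (1 - y) * (8 * (s\<^sup>2 * \<rho>\<^sup>2)) / 2"
    unfolding q2 by (simp add: algebra_simps)
  ultimately have "A\<^sup>2 \<le> E\<^sup>2 + (1 - y) * E\<^sup>2 / 2"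
    unfolding AE by linarith
  also have "\<dots> = E\<^sup>2 * (1 + (1 - y) / 2)"
    by (simp add: algebra_simps)
  finally have "A\<^sup>2 \<le> E\<^sup>2 * (1 + (1 - y) / 2)" .
  then have "y * A\<^sup>2 \<le> y * (E\<^sup>2 * (1 + (1 - y) / 2))"
    using y01(1) by (rule mult_left_mono)
  also have "\<dots> = E\<^sup>2 * (y * (1 + (1 - y) / 2))"
    by (rule mult.left_commute)
  \<comment> \<open>The two sides differ by E^2 (1 - y)^2 / 2.\<close>
  also have "\<dots> \<le> E\<^sup>2 * (1 - (1 - y) / 2)"
  proof (intro mult_left_mono)
    have "0 \<le> (1 - y)\<^sup>2" by simp
    then show "y * (1 + (1 - y) / 2) \<le> 1 - (1 - y) / 2"
      by (simp add: power2_eq_square field_simps)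
  qed simp
  also have "\<dots> \<le> E\<^sup>2 * exp (- \<delta> / 2)"
  proof (intro mult_left_mono)
    have "\<rho>\<^sup>2 - (cmod q)\<^sup>2 = (\<rho> - cmod q) * (\<rho> + cmod q)"
      by (simp add: power2_eq_square algebra_simps)
    also have "\<dots> \<ge> \<delta> * \<rho>"
      using assms by (intro mult_mono) auto
    finally have "\<rho>\<^sup>2 * (1 - y) \<ge> \<delta> * \<rho>"
      using q2 by (simp add: algebra_simps)
    then have "\<rho> * (1 - y) \<ge> \<delta>"
      using assms by (simp add: power2_eq_square mult.commute)
    moreover have "\<rho> * (1 - y) \<le> 1 * (1 - y)"
      using assms y01 by (intro mult_right_mono) auto
    ultimately have "1 - (1 - y) / 2 \<le> 1 + (- \<delta> / 2)" by simp
    also have "\<dots> \<le> exp (- \<delta> / 2)" by (rule exp_ge_add_one_self)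
    finally show "1 - (1 - y) / 2 \<le> exp (- \<delta> / 2)" .
  qed simp
  finally have "\<rho>\<^sup>2 * (y * A\<^sup>2) * exp (\<delta> / 2) \<le> \<rho>\<^sup>2 * (E\<^sup>2 * exp (- \<delta> / 2)) * exp (\<delta> / 2)"
    by (intro mult_right_mono mult_left_mono) auto
  also have "\<dots> = (\<rho> * E)\<^sup>2"
    by (simp add: power_mult_distrib exp_minus)
  also have "\<rho>\<^sup>2 * (y * A\<^sup>2) * exp (\<delta> / 2) = (cmod q * exp (\<delta> / 4) * A)\<^sup>2"
    by (simp add: power_mult_distrib q2 flip: exp_double)
  finally have "cmod q * exp (\<delta> / 4) * A \<le> \<rho> * E"
    by (rule power2_le_imp_le) (use assms(3) in \<open>simp add: E_def\<close>)
  then show ?thesis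
    unfolding E' A_def .
qed

section \<open>Dividing out zeros and counting them\<close>

lemma divide_linear_factor:
  fixes h :: "complex \<Rightarrow> complex"
  assumes "h holomorphic_on U" "open U" "a \<in> U \<Longrightarrow> h a = 0"
  obtains k where "k holomorphic_on U" "\<And>w. w \<in> U \<Longrightarrow> h w = k w * (w - a)"
proof (cases "a \<in> U")
  case True
  show ?thesis
  proof
    show "(\<lambda>z. if z = a then deriv h a else (h z - h a) / (z - a)) holomorphic_on U"
      using pole_lemma_open[OF assms(1,2)] .
  qed (use True assms(3) in auto)
next
  case False
  show ?thesis
  proof
    show "(\<lambda>z. h z / (z - a)) holomorphic_on U"
      using assms False by (auto intro!: holomorphic_intros)
  qed (use False in auto)
qed

text \<open>Each \<open>q\<close> is removed by dividing by \<open>w - c\<close> and then by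
  \<open>w + c\<close>, where \<open>c\<^sup>2 = q\<close>. As \<open>q \<noteq> 0\<close>, the two
  roots differ, so the zero at \<open>-c\<close> survives the first division. The factors of the
  other elements of \<open>Q\<close> do not vanish where \<open>w\<^sup>2 = q\<close>, so the zeros
  of \<open>g\<close> there are zeros of \<open>h\<close>.\<close>

lemma divide_quadratic_factors:
  fixes g :: "complex \<Rightarrow> complex"
  assumes "finite Q" "g holomorphic_on U" "open U"
    and "\<And>q. q \<in> Q \<Longrightarrow> q \<noteq> 0" "\<And>q w. q \<in> Q \<Longrightarrow> w \<in> U \<Longrightarrow> w\<^sup>2 = q \<Longrightarrow> g w = 0"
  shows "\<exists>h. h holomorphic_on U \<and> (\<forall>w\<in>U. g w = h w * (\<Prod>q\<in>Q. w\<^sup>2 - q))"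
  using assms(1,4,5)
proof (induction Q)
  case empty
  then show ?case using assms by auto
next
  case (insert q Q)
  have "\<exists>h. h holomorphic_on U \<and> (\<forall>w\<in>U. g w = h w * (\<Prod>q\<in>Q. w\<^sup>2 - q))"
    by (rule insert.IH) (use insert.prems in blast)+
  then obtain h where h: "h holomorphic_on U" "\<And>w. w \<in> U \<Longrightarrow> g w = h w * (\<Prod>q\<in>Q. w\<^sup>2 - q)"
    by blast
  define c where "c = csqrt q"
  have c: "c\<^sup>2 = q" "c \<noteq> 0" using insert by (auto simp: c_def)
  have h0: "h w = 0" if "w \<in> U" "w\<^sup>2 = q" for w
  proof -
    have "g w = 0" using insert.prems(2)[of q w] that by simp
    moreover have "(\<Prod>q\<in>Q. w\<^sup>2 - q) \<noteq> 0"
      using insert.hyps that by (auto simp: prod_zero_iff)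
    ultimately show ?thesis using h(2)[OF that(1)] by simp
  qed
  obtain k where k: "k holomorphic_on U" "\<And>w. w \<in> U \<Longrightarrow> h w = k w * (w - c)"
    using divide_linear_factor[OF h(1) assms(3), of c] h0 c by metis
  have "k (-c) = 0" if "-c \<in> U"
    using h0[OF that] k(2)[OF that] c by simp
  then obtain l where l: "l holomorphic_on U" "\<And>w. w \<in> U \<Longrightarrow> k w = l w * (w - (-c))"
    using divide_linear_factor[OF k(1) assms(3), of "-c"] by metis
  have "g w = l w * (\<Prod>q\<in>insert q Q. w\<^sup>2 - q)" if "w \<in> U" for w
  proof -
    have "w\<^sup>2 - q = (w + c) * (w - c)"
      by (simp add: c(1)[symmetric] power2_eq_square algebra_simps)
    then show ?thesis
      using that insert.hyps by (simp add: h(2) k(2) l(2))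
  qed
  then show ?case using l(1) by blast
qed

text \<open>A Jensen-type bound from the maximum principle: D(w) D(-w), divided by the Blaschke
  factors of \<open>Q\<close> and damped by an exponential, is at most 1 on the frontier of the
  domain and hence at 0. There every zero contributes a factor exp(\<delta> / 4), while the damping
  costs a factor whose exponent is of order C / (\<delta>^2 s).\<close>

lemma zero_count_squares:
  fixes D :: "complex \<Rightarrow> complex" and C \<delta> s :: real
  assumes holo: "D holomorphic_on ball 0 1" and D0: "D 0 = 1"
    and growth: "\<And>w. cmod w < 1 \<Longrightarrow> cmod (D w) \<le> exp (C / ((1 - cmod w)\<^sup>2 * (cmod (1 - w\<^sup>2))\<^sup>2))"
    and C: "C \<ge> 0" and \<delta>: "0 < \<delta>" "\<delta> \<le> 1/2" and s: "0 < s" "s \<le> 1/2"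
    and fin: "finite Q"
    and Q: "\<And>q. q \<in> Q \<Longrightarrow> q \<noteq> 0 \<and> cmod q \<le> 1 - 2 * \<delta> \<and> 8 * s \<le> cmod (1 - q) \<and> (\<exists>w. w\<^sup>2 = q \<and> D w = 0)"
  shows "card Q \<le> 512 * C / (\<delta> ^ 3 * s)"
proof -
  define \<rho> where "\<rho> = 1 - \<delta>"
  have \<rho>: "1/2 \<le> \<rho>" "\<rho> < 1" "0 < \<rho>" using \<delta> by (auto simp: \<rho>_def)
  \<comment> \<open>The product vanishes at both square roots of each \<open>q\<close>, whichever of
    them is a zero of \<open>D\<close>.\<close>
  define g where "g = (\<lambda>w. D w * D (- w))"
  have holg: "g holomorphic_on ball 0 1"
  proof -
    have "(D \<circ> uminus) holomorphic_on ball 0 1"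
      by (rule holomorphic_on_compose_gen[OF _ holo]) (auto intro: holomorphic_intros)
    then show ?thesis
      unfolding g_def using holo by (auto intro!: holomorphic_intros simp: o_def)
  qed
  have g_zero: "g w = 0" if "q \<in> Q" "w\<^sup>2 = q" for q w :: complex
  proof -
    obtain v where "v\<^sup>2 = q" "D v = 0" using Q \<open>q \<in> Q\<close> by blast
    then have "v = w \<or> v = - w" using that(2) power2_eq_iff by metis
    then show ?thesis using \<open>D v = 0\<close> by (auto simp: g_def)
  qed
  obtain h where h: "h holomorphic_on ball 0 1" 
    "\<And>w. w \<in> ball 0 1 \<Longrightarrow> g w = h w * (\<Prod>q\<in>Q. w\<^sup>2 - q)"
    using divide_quadratic_factors[OF fin holg open_ball] Q g_zero by metis
  \<comment> \<open>Up to a unimodular constant, the Blaschke factor of \<open>q\<close> at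
    \<open>x\<close> is \<rho> (x - q) \<open>A q x\<close> divided by (\<rho>^2 - x
    \<open>cnj q\<close>) \<open>E q x\<close>.\<close>
  define A where "A = (\<lambda>(q::complex) (x::complex). (\<rho> - x) * (\<rho> - q) + s\<^sup>2 * (\<rho> + x) * (\<rho> + q))"
  define E where "E = (\<lambda>(q::complex) (x::complex). (\<rho> - x) * (\<rho> - cnj q) - s\<^sup>2 * (\<rho> + x) * (\<rho> + cnj q))"
  define t where "t = s / 2"
  \<comment> \<open>\<open>Re H\<close> majorises \<open>1 / |\<rho> - x|\<^sup>2\<close> on the domain, while \<open>H(0)\<close> is only of size \<open>1 / s\<close>.\<close>
  define H where "H = (\<lambda>x::complex. (4 / t) / (\<rho> + t - x))"
  \<comment> \<open>Both factors of \<open>g\<close> obey the growth bound and 1 - |w| is at least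
    \<delta> / 2 on the domain, which gives 2 C (2 / \<delta>)^2.\<close>
  define \<kappa> where "\<kappa> = 8 * C / \<delta>\<^sup>2"
  \<comment> \<open>Each \<open>w\<^sup>2 - q\<close> split off from \<open>g\<close> is replaced by
    a zero-free-denominator quotient that has the same modulus on the frontier; the exponential
    absorbs the growth of \<open>g\<close>.\<close>
  define F where "F = (\<lambda>w. h w * (\<Prod>q\<in>Q. (complex_of_real (\<rho>\<^sup>2) - w\<^sup>2 * cnj q) * E q (w\<^sup>2) / (\<rho> * A q (w\<^sup>2))) * exp (- (\<kappa> * H (w\<^sup>2))))"
  \<comment> \<open>The preimage under squaring of the disc |x| < \<rho> with a neighbourhood of
    \<rho> removed; the second condition is |u| > s.\<close>
  define S where "S = {w::complex. cmod (w\<^sup>2) < \<rho>} \<inter> {w::complex. s * cmod (\<rho> + w\<^sup>2) < cmod (\<rho> - w\<^sup>2)}"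
  define K where "K = {w::complex. cmod (w\<^sup>2) \<le> \<rho>} \<inter> {w::complex. s * cmod (\<rho> + w\<^sup>2) \<le> cmod (\<rho> - w\<^sup>2)}"
  have t: "0 < t" using s by (simp add: t_def)
  have \<kappa>: "0 \<le> \<kappa>" using C \<delta> by (simp add: \<kappa>_def)
  have openS: "open S"
    unfolding S_def by (intro open_Int open_Collect_less continuous_intros)
  have closedK: "closed K"
    unfolding K_def by (intro closed_Int closed_Collect_le continuous_intros)
  have SK: "S \<subseteq> K" by (auto simp: S_def K_def)
  have clS: "closure S \<subseteq> K" using SK closedK by (rule closure_minimal)
  have K1: "cmod w < 1" if "w \<in> K" for w :: complex
  proof -
    have "(cmod w)\<^sup>2 < 1\<^sup>2" using that \<rho> by (auto simp: K_def norm_power)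
    then show ?thesis using power2_less_imp_less by fastforce
  qed
  then have Kball: "K \<subseteq> ball 0 1" by auto
  \<comment> \<open>Far from \<rho> in the sense of the quotient |u| implies far in absolute
    distance, because \<rho> - w^2 and \<rho> + w^2 add up to 2 \<rho>.\<close>
  have Pt: "t \<le> cmod (\<rho> - w\<^sup>2)" if "w \<in> K" for w :: complex
  proof -
    have "2 * \<rho> = cmod ((\<rho> - w\<^sup>2) + (\<rho> + w\<^sup>2))" using \<rho> by simp
    also have "\<dots> \<le> cmod (\<rho> - w\<^sup>2) + cmod (\<rho> + w\<^sup>2)" by (rule norm_triangle_ineq)
    finally have "s * (2 * \<rho>) \<le> s * (cmod (\<rho> - w\<^sup>2) + cmod (\<rho> + w\<^sup>2))"
      using s by (intro mult_left_mono) auto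
    also have "\<dots> \<le> s * cmod (\<rho> - w\<^sup>2) + cmod (\<rho> - w\<^sup>2)"
      using that by (simp add: K_def distrib_left)
    also have "\<dots> \<le> (1/2) * cmod (\<rho> - w\<^sup>2) + cmod (\<rho> - w\<^sup>2)"
      using s by (intro add_right_mono mult_right_mono) auto
    finally have "s * (2 * \<rho>) \<le> (3/2) * cmod (\<rho> - w\<^sup>2)" by simp
    moreover have "s * 1 \<le> s * (2 * \<rho>)" using s \<rho> by (intro mult_left_mono) auto
    ultimately show ?thesis using s unfolding t_def by linarith
  qed
  have Q': "cmod q \<le> \<rho> - \<delta>" "4 * s \<le> cmod (\<rho> - q)" "s * cmod (\<rho> + q) < cmod (\<rho> - q)" if "q \<in> Q" for q :: complex
  proof -
    show 1: "cmod q \<le> \<rho> - \<delta>" using Q[OF that] by (simp add: \<rho>_def)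
    have "1 - cmod q \<le> cmod (1 - q)" by (metis norm_one norm_triangle_ineq2)
    moreover have "cmod (1 - q) \<le> cmod (\<rho> - q) + cmod \<delta>"
      using norm_triangle_ineq[of "\<rho> - q" "complex_of_real \<delta>"] by (simp add: \<rho>_def)
    ultimately show 2: "4 * s \<le> cmod (\<rho> - q)"
      using Q[OF that] \<delta> by simp
    have "cmod (\<rho> + q) \<le> 2"
      using norm_triangle_ineq[of "complex_of_real \<rho>" q] 1 \<delta> \<rho> by simp
    then have "s * cmod (\<rho> + q) \<le> s * 2" using s by (intro mult_left_mono) auto
    then show "s * cmod (\<rho> + q) < cmod (\<rho> - q)" using 2 s by linarith
  qed
  have A_nz: "A q (w\<^sup>2) \<noteq> 0" if "q \<in> Q" "w \<in> K" for q w :: complex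
  proof
    assume "A q (w\<^sup>2) = 0"
    then have "(\<rho> - w\<^sup>2) * (\<rho> - q) = - (s\<^sup>2 * (\<rho> + w\<^sup>2) * (\<rho> + q))"
      by (simp add: A_def eq_neg_iff_add_eq_0)
    then have "cmod ((\<rho> - w\<^sup>2) * (\<rho> - q)) = cmod (s\<^sup>2 * (\<rho> + w\<^sup>2) * (\<rho> + q))"
      by (metis norm_minus_cancel)
    then have e: "cmod (\<rho> - w\<^sup>2) * cmod (\<rho> - q) = (s * cmod (\<rho> + w\<^sup>2)) * (s * cmod (\<rho> + q))"
      by (simp add: norm_mult norm_power power2_eq_square mult_ac)
    have "(s * cmod (\<rho> + w\<^sup>2)) * (s * cmod (\<rho> + q)) \<le> cmod (\<rho> - w\<^sup>2) * (s * cmod (\<rho> + q))"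
      using that s by (intro mult_right_mono) (auto simp: K_def)
    also have "\<dots> < cmod (\<rho> - w\<^sup>2) * cmod (\<rho> - q)"
      using Q'[OF that(1)] Pt[OF that(2)] t by (intro mult_strict_left_mono) auto
    finally show False using e by simp
  qed
  have denom: "t \<le> Re (\<rho> + t - w\<^sup>2)" if "w \<in> K" for w :: complex
    using that complex_Re_le_cmod[of "w\<^sup>2"] by (simp add: K_def)
  then have denom_nz: "\<rho> + t - w\<^sup>2 \<noteq> 0" if "w \<in> K" for w :: complex
    using that t by (metis leD zero_complex.simps(1))
  have ReH: "1 / (cmod (\<rho> - w\<^sup>2))\<^sup>2 \<le> Re (H (w\<^sup>2))" if "w \<in> K" for w :: complex
  proof -
    let ?d = "\<rho> + t - w\<^sup>2" and ?P = "\<rho> - w\<^sup>2"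
    have P: "0 < cmod ?P" using Pt[OF that] t by linarith
    have "?d = ?P + complex_of_real t" by simp
    then have "cmod ?d \<le> cmod ?P + cmod (complex_of_real t)"
      by (metis norm_triangle_ineq)
    moreover have "cmod (complex_of_real t) = t" using t by simp
    ultimately have "cmod ?d \<le> 2 * cmod ?P" using Pt[OF that] by linarith
    then have d2: "(cmod ?d)\<^sup>2 \<le> 4 * (cmod ?P)\<^sup>2"
      using power_mono[of "cmod ?d" "2 * cmod ?P" 2] by (simp add: power_mult_distrib)
    have dpos: "0 < (cmod ?d)\<^sup>2" using denom_nz[OF that] by simp
    have "H (w\<^sup>2) = complex_of_real (4 / t) * (1 / ?d)" by (simp add: H_def)
    then have "Re (H (w\<^sup>2)) = (4 / t) * (Re ?d / (cmod ?d)\<^sup>2)"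
      by (simp add: Re_divide cmod_power2 del: of_real_divide)
    also have "\<dots> \<ge> (4 / t) * (t / (cmod ?d)\<^sup>2)"
      using denom[OF that] t by (intro mult_left_mono divide_right_mono) auto
    also have "(4 / t) * (t / (cmod ?d)\<^sup>2) = 4 / (cmod ?d)\<^sup>2" using t by simp
    also have "\<dots> \<ge> 4 / (4 * (cmod ?P)\<^sup>2)"
      using d2 dpos P by (intro divide_left_mono) auto
    finally show ?thesis by simp
  qed
  have g_bound: "cmod (g w) \<le> exp (\<kappa> * Re (H (w\<^sup>2)))" if "w \<in> K" for w :: complex
  proof -
    have w1: "cmod w < 1" using K1 that by blast
    have "(cmod w)\<^sup>2 \<le> 1 - \<delta>" using that by (simp add: K_def norm_power \<rho>_def)
    moreover have "0 \<le> (1 - cmod w)\<^sup>2" by simp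
    ultimately have dw: "\<delta> / 2 \<le> 1 - cmod w"
      by (simp add: power2_eq_square algebra_simps)
    let ?Y = "(1 - cmod w)\<^sup>2 * (cmod (1 - w\<^sup>2))\<^sup>2"
    have P: "0 < cmod (\<rho> - w\<^sup>2)" using Pt[OF that] t by linarith
    \<comment> \<open>The real part of \<open>w\<^sup>2\<close> is at most \<rho>, so
      \<open>w\<^sup>2\<close> is closer to \<rho> than to 1.\<close>
    have "cmod (\<rho> - w\<^sup>2) \<le> cmod (1 - w\<^sup>2)"
    proof -
      have "(cmod (1 - w\<^sup>2))\<^sup>2 - (cmod (\<rho> - w\<^sup>2))\<^sup>2 = (1 - \<rho>) * ((1 + \<rho>) - 2 * Re (w\<^sup>2))"
        unfolding cmod_power2 by (simp add: power2_eq_square algebra_simps)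
      also have "\<dots> \<ge> 0"
        using \<rho> that complex_Re_le_cmod[of "w\<^sup>2"] by (intro mult_nonneg_nonneg) (auto simp: K_def)
      finally have "(cmod (\<rho> - w\<^sup>2))\<^sup>2 \<le> (cmod (1 - w\<^sup>2))\<^sup>2" by linarith
      then show ?thesis by (rule power2_le_imp_le) simp
    qed
    then have le1: "(\<delta> / 2)\<^sup>2 * (cmod (\<rho> - w\<^sup>2))\<^sup>2 \<le> ?Y"
      using dw \<delta> by (intro mult_mono power_mono) auto
    have pos: "0 < (\<delta> / 2)\<^sup>2 * (cmod (\<rho> - w\<^sup>2))\<^sup>2"
      using \<delta> P by (intro mult_pos_pos zero_less_power) auto
    have "2 * C / ?Y \<le> 2 * C / ((\<delta> / 2)\<^sup>2 * (cmod (\<rho> - w\<^sup>2))\<^sup>2)"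
      by (rule frac_le[OF _ order.refl pos le1]) (use C in simp)
    also have "\<dots> = \<kappa> * (1 / (cmod (\<rho> - w\<^sup>2))\<^sup>2)"
      by (simp add: \<kappa>_def power_divide)
    also have "\<dots> \<le> \<kappa> * Re (H (w\<^sup>2))"
      using ReH[OF that] \<kappa> by (rule mult_left_mono)
    finally have le: "2 * C / ?Y \<le> \<kappa> * Re (H (w\<^sup>2))" .
    have "cmod (g w) = cmod (D w) * cmod (D (-w))" by (simp add: g_def norm_mult)
    also have "\<dots> \<le> exp (C / ?Y) * exp (C / ?Y)"
      using growth[OF w1] growth[of "-w"] w1 by (intro mult_mono) auto
    also have "\<dots> = exp (2 * C / ?Y)" by (simp flip: exp_add)
    finally show ?thesis using le by (meson exp_le_cancel_iff order_trans)
  qed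
  have h_eq: "cmod (h w) * (\<Prod>q\<in>Q. cmod (w\<^sup>2 - q)) = cmod (g w)" if "w \<in> ball 0 1" for w :: complex
    using h(2)[OF that] by (simp add: norm_mult prod_norm)
  have F_norm: "cmod (F w) = cmod (h w) * (\<Prod>q\<in>Q. cmod (complex_of_real (\<rho>\<^sup>2) - w\<^sup>2 * cnj q) * cmod (E q (w\<^sup>2)) / (\<rho> * cmod (A q (w\<^sup>2))))
       * exp (- (\<kappa> * Re (H (w\<^sup>2))))" for w :: complex
    using \<rho> by (simp add: F_def norm_mult norm_divide flip: prod_norm)
  have front: "cmod (F w) \<le> 1" if "w \<in> frontier S" for w :: complex
  proof -
    have wK: "w \<in> K" using that clS by (auto simp: frontier_def)
    have "w \<notin> S" using that openS by (simp add: frontier_def interior_open)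
    then have bd: "cmod (w\<^sup>2) = \<rho> \<or> cmod (\<rho> - w\<^sup>2) = s * cmod (\<rho> + w\<^sup>2)"
      using wK by (auto simp: S_def K_def)
    have "cmod (complex_of_real (\<rho>\<^sup>2) - w\<^sup>2 * cnj q) * cmod (E q (w\<^sup>2)) / (\<rho> * cmod (A q (w\<^sup>2))) = cmod (w\<^sup>2 - q)" if "q \<in> Q" for q :: complex
    proof -
      have "\<rho> * cmod (w\<^sup>2 - q) * cmod (A q (w\<^sup>2)) = cmod (complex_of_real (\<rho>\<^sup>2) - w\<^sup>2 * cnj q) * cmod (E q (w\<^sup>2))"
        unfolding A_def E_def by (rule blaschke_boundary[OF s(1) \<rho>(3) bd])
      from this[symmetric] show ?thesis
        using A_nz[OF that wK] \<rho> by (simp only:) simp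
    qed
    then have "cmod (F w) = cmod (g w) * exp (- (\<kappa> * Re (H (w\<^sup>2))))"
      using h_eq[of w] Kball wK by (auto simp: F_norm)
    also have "\<dots> \<le> exp (\<kappa> * Re (H (w\<^sup>2))) * exp (- (\<kappa> * Re (H (w\<^sup>2))))"
      using g_bound[OF wK] by (intro mult_right_mono) auto
    finally show ?thesis by (simp flip: exp_add)
  qed
  have holF: "F holomorphic_on K'" if "K' \<subseteq> K" for K'
  proof -
    have [simp]: "\<rho> \<noteq> 0" using \<rho> by simp
    have [holomorphic_intros]: "h holomorphic_on K'"
      using h(1) Kball that by (meson holomorphic_on_subset order_trans)
    show ?thesis
      unfolding F_def H_def E_def A_def
      by (intro holomorphic_intros) (use that A_nz denom_nz in \<open>auto simp: A_def\<close>)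
  qed
  have S0: "0 \<in> S" using \<rho> s by (simp add: S_def)
  have "cmod (F 0) \<le> 1"
  proof (rule maximum_modulus_frontier[OF _ _ _ front S0])
    show "F holomorphic_on interior S" using holF interior_subset SK by (meson order_trans)
    show "continuous_on (closure S) F" using holF[OF clS] by (rule holomorphic_on_imp_continuous_on)
    show "bounded S" using SK Kball bounded_ball bounded_subset by blast
  qed
  moreover have "exp (card Q * (\<delta> / 4)) * exp (- (\<kappa> * (16 / s))) \<le> cmod (F 0)"
  proof -
    define X where "X = (\<lambda>q. cmod (complex_of_real (\<rho>\<^sup>2) - 0 * cnj q) * cmod (E q 0) / (\<rho> * cmod (A q 0)))"
    have "cmod q * exp (\<delta> / 4) \<le> X q" if "q \<in> Q" for q :: complex
    proof -
      have "E q 0 = \<rho> * ((\<rho> - cnj q) - s\<^sup>2 * (\<rho> + cnj q))" "A q 0 = \<rho> * ((\<rho> - q) + s\<^sup>2 * (\<rho> + q))"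
        by (simp_all add: E_def A_def algebra_simps)
      then have n: "cmod (E q 0) = \<rho> * cmod ((\<rho> - cnj q) - s\<^sup>2 * (\<rho> + cnj q))"
        "cmod (A q 0) = \<rho> * cmod ((\<rho> - q) + s\<^sup>2 * (\<rho> + q))"
        using \<rho> by (metis norm_mult norm_of_real abs_of_pos)+
      have "cmod q * exp (\<delta> / 4) * cmod ((\<rho> - q) + s\<^sup>2 * (\<rho> + q)) \<le> \<rho> * cmod ((\<rho> - cnj q) - s\<^sup>2 * (\<rho> + cnj q))"
        using Q'[OF that] by (intro blaschke_at_zero s \<rho> \<delta>)
      then have "cmod q * exp (\<delta> / 4) * cmod (A q 0) \<le> \<rho> * cmod (E q 0)"
        unfolding n using \<rho>(3) by (simp add: mult.left_commute)
      moreover have "cmod (A q 0) > 0"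
        using A_nz[OF that, of 0] S0 SK by auto
      moreover have "X q = \<rho> * cmod (E q 0) / cmod (A q 0)"
        using \<rho> by (simp add: X_def norm_power norm_mult power2_eq_square)
      ultimately show ?thesis
        by (simp only: pos_le_divide_eq)
    qed
    then have "(\<Prod>q\<in>Q. cmod q * exp (\<delta> / 4)) \<le> (\<Prod>q\<in>Q. X q)"
      by (intro prod_mono) (simp add: less_imp_le)
    moreover have "(\<Prod>q\<in>Q. cmod q * exp (\<delta> / 4)) = (\<Prod>q\<in>Q. cmod q) * exp (card Q * (\<delta> / 4))"
      by (simp only: prod.distrib prod_constant exp_of_nat_mult)
    ultimately have "cmod (h 0) * ((\<Prod>q\<in>Q. cmod q) * exp (card Q * (\<delta> / 4))) \<le> cmod (h 0) * (\<Prod>q\<in>Q. X q)"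
      by (intro mult_left_mono norm_ge_zero) (simp only:)
    \<comment> \<open>The normalisation \<open>D 0 = 1\<close> enters here: the product of the |q|
      cancels exactly and only the exponential gains remain.\<close>
    moreover have "cmod (h 0) * (\<Prod>q\<in>Q. cmod q) = 1"
      using h_eq[of 0] D0 by (simp add: g_def)
    ultimately have 1: "exp (card Q * (\<delta> / 4)) \<le> cmod (h 0) * (\<Prod>q\<in>Q. X q)"
      by (simp only: mult.assoc[symmetric] mult_1)
    have "H 0 = complex_of_real (4 / t / (\<rho> + t))" by (simp add: H_def)
    then have "Re (H 0) = 4 / t / (\<rho> + t)" by (simp only: Re_complex_of_real)
    also have "\<dots> \<le> 4 / t / (1/2)"
      by (rule divide_left_mono) (use t \<rho> in auto)
    finally have "Re (H 0) \<le> 16 / s" by (simp add: t_def)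
    then have 2: "exp (- (\<kappa> * (16 / s))) \<le> exp (- (\<kappa> * Re (H 0)))"
      unfolding exp_le_cancel_iff neg_le_iff_le using \<kappa> by (rule mult_left_mono)
    have "exp (card Q * (\<delta> / 4)) * exp (- (\<kappa> * (16 / s))) \<le> cmod (h 0) * (\<Prod>q\<in>Q. X q) * exp (- (\<kappa> * Re (H 0)))"
      by (rule mult_mono[OF 1 2 order_trans[OF _ 1]]) simp_all
    then show ?thesis
      unfolding F_norm X_def by simp
  qed
  ultimately have "exp (card Q * (\<delta> / 4) + - (\<kappa> * (16 / s))) \<le> exp 0"
    unfolding exp_add by (simp del: exp_le_one_iff)
  then have "card Q * (\<delta> / 4) \<le> \<kappa> * (16 / s)" by simp
  then have "card Q * (\<delta> / 4) * (4 / \<delta>) \<le> \<kappa> * (16 / s) * (4 / \<delta>)"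
    using \<delta> by (intro mult_right_mono) auto
  then show ?thesis
    using \<delta> by (simp add: \<kappa>_def power2_eq_square power3_eq_cube mult_ac)
qed

section \<open>Dyadic summation over the zeros\<close>

lemma dyadic_level:
  fixes x :: real
  assumes "0 < x" "x \<le> 1"
  obtains n where "(1/2) ^ Suc n \<le> x" "x \<le> (1/2) ^ n"
proof -
  define n where "n = (LEAST n. (1/2) ^ Suc n \<le> x)"
  obtain k where "(1/2::real) ^ k < x"
    using real_arch_pow_inv[of x "1/2"] assms by auto
  moreover have "(1/2::real) ^ Suc k \<le> (1/2) ^ k" by simp
  ultimately have "(1/2) ^ Suc k \<le> x" by linarith
  then have 1: "(1/2) ^ Suc n \<le> x"
    unfolding n_def by (rule LeastI)
  have "x \<le> (1/2) ^ n"
  proof (cases n)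
    case (Suc j)
    then have "\<not> (1/2) ^ Suc j \<le> x"
      using not_less_Least[of j "\<lambda>n. (1/2) ^ Suc n \<le> x"] unfolding n_def by simp
    then show ?thesis using Suc by simp
  qed (use assms in simp)
  with 1 show ?thesis by (rule that)
qed

text \<open>The cell with \<open>a\<close> near 2^-j and \<open>b\<close> near 2^-k contains at most
  16 C 8^j 2^k indices, which cancels the exponents 3 and 1 of the weight. The surplus \<tau> leaves
  \<theta>^j \<theta>^k with \<theta> = 2^-\<tau> < 1, a convergent double geometric series.\<close>

lemma summable_on_of_dyadic_counts:
  fixes a b :: "'i \<Rightarrow> real"
  assumes ab: "\<And>i. i \<in> W \<Longrightarrow> 0 < a i \<and> a i \<le> 1 \<and> 0 < b i \<and> b i \<le> 1"
    and count: "\<And>\<delta> s T. 0 < \<delta> \<Longrightarrow> \<delta> \<le> 1 \<Longrightarrow> 0 < s \<Longrightarrow> s \<le> 1 \<Longrightarrow> finite T \<Longrightarrow> T \<subseteq> W \<Longrightarrow>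
        (\<And>i. i \<in> T \<Longrightarrow> \<delta> \<le> a i \<and> s \<le> b i) \<Longrightarrow> real (card T) \<le> C / (\<delta> ^ 3 * s)"
    and "C \<ge> 0" "\<tau> > 0"
  shows "(\<lambda>i. a i powr (3 + \<tau>) * b i powr (1 + \<tau>)) summable_on W"
proof -
  define \<theta> :: real where "\<theta> = (1/2) powr \<tau>"
  have \<theta>: "0 \<le> \<theta>" "\<theta> < 1"
    using powr_less_mono2[of \<tau> "1/2" 1] assms(4) by (auto simp: \<theta>_def)
  have "\<forall>i\<in>W. \<exists>n. (1/2) ^ Suc n \<le> a i \<and> a i \<le> (1/2) ^ n"
    using ab dyadic_level by metis
  then obtain m where m: "\<And>i. i \<in> W \<Longrightarrow> (1/2) ^ Suc (m i) \<le> a i \<and> a i \<le> (1/2) ^ m i"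
    by metis
  have "\<forall>i\<in>W. \<exists>n. (1/2) ^ Suc n \<le> b i \<and> b i \<le> (1/2) ^ n"
    using ab dyadic_level by metis
  then obtain n where n: "\<And>i. i \<in> W \<Longrightarrow> (1/2) ^ Suc (n i) \<le> b i \<and> b i \<le> (1/2) ^ n i"
    by metis
  define g where "g = (\<lambda>(j, k). ((1/2) ^ (3 * j) * \<theta> ^ j) * ((1/2) ^ k * \<theta> ^ k))"
  have pw: "((1/2) ^ j) powr (real c + \<tau>) = (1/2) ^ (c * j) * \<theta> ^ j" for j c :: nat
  proof -
    have "((1/2::real) ^ j) powr (real c + \<tau>) = ((1/2) powr real j) powr (real c + \<tau>)"
      by (simp add: powr_realpow)
    also have "\<dots> = (1/2) powr (real (c * j)) * ((1/2) powr \<tau>) powr real j"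
      by (simp add: powr_powr powr_add[symmetric] algebra_simps)
    also have "\<dots> = (1/2) ^ (c * j) * \<theta> ^ j"
      unfolding \<theta>_def by (subst (1 2) powr_realpow) auto
    finally show ?thesis .
  qed
  have le_g: "a i powr (3 + \<tau>) * b i powr (1 + \<tau>) \<le> g (m i, n i)" if "i \<in> W" for i
  proof -
    have "a i powr (3 + \<tau>) \<le> ((1/2) ^ m i) powr (3 + \<tau>)"
      using m[OF that] ab[OF that] assms(4) by (intro powr_mono2) auto
    moreover have "b i powr (1 + \<tau>) \<le> ((1/2) ^ n i) powr (1 + \<tau>)"
      using n[OF that] ab[OF that] assms(4) by (intro powr_mono2) auto
    ultimately show ?thesis
      using pw[of "m i" 3] pw[of "n i" 1] \<theta>(1) unfolding g_def by (auto intro!: mult_mono)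
  qed
  have geo: "(\<Sum>j\<le>N. \<theta> ^ j) \<le> 1 / (1 - \<theta>)" for N
    using sum_le_suminf[of "\<lambda>j. \<theta> ^ j" "{..N}"] \<theta> by (simp add: suminf_geometric summable_geometric)
  have bound: "(\<Sum>i\<in>T. a i powr (3 + \<tau>) * b i powr (1 + \<tau>)) \<le> 16 * C * (1 / (1 - \<theta>))\<^sup>2"
    if T: "T \<subseteq> W" "finite T" for T
  proof -
    define N where "N = Max (insert 0 (m ` T \<union> n ` T))"
    have N: "m i \<le> N" "n i \<le> N" if "i \<in> T" for i
      using that T unfolding N_def by (auto intro!: Max_ge)
    have "(\<Sum>i\<in>T. a i powr (3 + \<tau>) * b i powr (1 + \<tau>)) \<le> (\<Sum>i\<in>T. g (m i, n i))"
      using le_g T by (intro sum_mono) auto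
    also have "\<dots> = (\<Sum>y\<in>{..N} \<times> {..N}. real (card {i \<in> T. (m i, n i) = y}) * g y)"
      using N by (intro sum_fun_comp T) auto
    also have "\<dots> \<le> (\<Sum>(j, k)\<in>{..N} \<times> {..N}. 16 * C * (\<theta> ^ j * \<theta> ^ k))"
    proof (intro sum_mono, clarify)
      fix j k
      have "real (card {i \<in> T. (m i, n i) = (j, k)}) \<le> C / (((1/2) ^ Suc j) ^ 3 * (1/2) ^ Suc k)"
      proof (rule count)
        show "(1/2::real) ^ Suc j \<le> 1" "(1/2::real) ^ Suc k \<le> 1"
          by (rule power_le_one; simp)+
        show "(1/2) ^ Suc j \<le> a i \<and> (1/2) ^ Suc k \<le> b i" if "i \<in> {i \<in> T. (m i, n i) = (j, k)}" for i
          using that m[of i] n[of i] T by auto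
      qed (use T in auto)
      then have "real (card {i \<in> T. (m i, n i) = (j, k)}) * g (j, k) \<le>
          C / (((1/2) ^ Suc j) ^ 3 * (1/2) ^ Suc k) * g (j, k)"
        using \<theta> by (intro mult_right_mono) (auto simp: g_def)
      also have "\<dots> = 16 * C * (\<theta> ^ j * \<theta> ^ k)"
        by (simp add: g_def power_mult power_mult_distrib power_one_over flip: power_mult)
           (simp add: power_mult power3_eq_cube field_simps)
      finally show "real (card {i \<in> T. (m i, n i) = (j, k)}) * g (j, k) \<le> 16 * C * (\<theta> ^ j * \<theta> ^ k)" .
    qed
    also have "\<dots> = 16 * C * ((\<Sum>j\<le>N. \<theta> ^ j) * (\<Sum>k\<le>N. \<theta> ^ k))"
      by (subst sum_product, subst sum.cartesian_product) (simp add: sum_distrib_left case_prod_unfold)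
    also have "\<dots> \<le> 16 * C * (1 / (1 - \<theta>) * (1 / (1 - \<theta>)))"
      using geo[of N] \<theta> assms(3) by (intro mult_left_mono mult_mono sum_nonneg) auto
    finally show ?thesis by (simp add: power2_eq_square)
  qed
  show ?thesis
  proof (rule nonneg_bdd_above_summable_on)
    show "bdd_above (sum (\<lambda>i. a i powr (3 + \<tau>) * b i powr (1 + \<tau>)) ` {F. F \<subseteq> W \<and> finite F})"
      by (rule bdd_aboveI[where M = "16 * C * (1 / (1 - \<theta>))\<^sup>2"]) (use bound in auto)
  qed auto
qed

text \<open>Transfers a count of the values w^2 to a count of the zeros w.\<close>

lemma card_le_2_card_squares:
  fixes T :: "complex set"
  assumes "finite T"
  shows "card T \<le> 2 * card ((\<lambda>w. w\<^sup>2) ` T)"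
proof -
  have "card {w \<in> T. w\<^sup>2 = q} \<le> 2" for q
  proof -
    have "w = csqrt q \<or> w = - csqrt q" if "w\<^sup>2 = q" for w
      using that by (metis power2_csqrt power2_eq_iff)
    then have "{w \<in> T. w\<^sup>2 = q} \<subseteq> {csqrt q, - csqrt q}"
      by blast
    then have "card {w \<in> T. w\<^sup>2 = q} \<le> card {csqrt q, - csqrt q}"
      by (intro card_mono) auto
    also have "\<dots> \<le> 2" by (simp add: card_insert_if)
    finally show ?thesis .
  qed
  then have "(\<Sum>q\<in>(\<lambda>w. w\<^sup>2) ` T. card {w \<in> T. w\<^sup>2 = q}) \<le> (\<Sum>q\<in>(\<lambda>w. w\<^sup>2) ` T. 2)"
    by (rule sum_mono)
  moreover have "card T = (\<Sum>q\<in>(\<lambda>w. w\<^sup>2) ` T. card {w \<in> T. w\<^sup>2 = q})"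
    using sum_fun_comp[of T "(\<lambda>w. w\<^sup>2) ` T" "\<lambda>w. w\<^sup>2" "\<lambda>_. 1::nat"] assms by simp
  ultimately show ?thesis by simp
qed

theorem zeros_summable:
  fixes D :: "complex \<Rightarrow> complex" and C \<tau> :: real
  assumes holo: "D holomorphic_on ball 0 1" and D0: "D 0 = 1"
    and growth: "\<And>w. cmod w < 1 \<Longrightarrow> cmod (D w) \<le> exp (C / ((1 - cmod w)\<^sup>2 * (cmod (1 - w\<^sup>2))\<^sup>2))"
    and C: "C \<ge> 0" and \<tau>: "\<tau> > 0"
    and W: "\<And>w. w \<in> W \<Longrightarrow> cmod w < 1 \<and> D w = 0"
  shows "(\<lambda>w. (1 - (cmod w)\<^sup>2) powr (3 + \<tau>) * (cmod (1 - w\<^sup>2)) powr (1 + \<tau>)) summable_on W"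
proof -
  define a where "a = (\<lambda>w. 1 - (cmod w)\<^sup>2)"
  \<comment> \<open>Halving brings the values on \<open>W\<close> into (0, 1], as the dyadic lemma
    requires; the factor \<open>2 powr (1 + \<tau>)\<close> undoes it at the end.\<close>
  define b where "b = (\<lambda>w. cmod (1 - w\<^sup>2) / 2)"
  have "(\<lambda>w. a w powr (3 + \<tau>) * b w powr (1 + \<tau>)) summable_on W"
  proof (rule summable_on_of_dyadic_counts[where C = "32768 * C"])
    show "0 < a w \<and> a w \<le> 1 \<and> 0 < b w \<and> b w \<le> 1" if "w \<in> W" for w
    proof -
      have w: "cmod w < 1" using W that by blast
      then have "(cmod w)\<^sup>2 < 1" by (simp add: abs_square_less_1)
      moreover have "1 - (cmod w)\<^sup>2 \<le> cmod (1 - w\<^sup>2)" 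
        using norm_triangle_ineq2[of 1 "w\<^sup>2"] by (simp add: norm_power)
      moreover have "cmod (1 - w\<^sup>2) \<le> 1 + (cmod w)\<^sup>2"
        using norm_triangle_ineq4[of 1 "w\<^sup>2"] by (simp add: norm_power)
      ultimately show ?thesis
        unfolding a_def b_def using zero_le_power2[of "cmod w"] by (intro conjI; linarith)
    qed
    fix \<delta> s :: real and T
    assume *: "0 < \<delta>" "\<delta> \<le> 1" "0 < s" "s \<le> 1" "finite T" "T \<subseteq> W" "\<And>w. w \<in> T \<Longrightarrow> \<delta> \<le> a w \<and> s \<le> b w"
    \<comment> \<open>The counting lemma asks for |q| at most 1 minus twice its first parameter and
      |1 - q| at least 8 times its second. Here |1 - q| is 2 \<open>b w\<close>, hence at least 2 s,
      so the parameters are \<delta> / 2 and s / 4.\<close>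
    have "real (card ((\<lambda>w. w\<^sup>2) ` T)) \<le> 512 * C / ((\<delta> / 2) ^ 3 * (s / 4))"
    proof (rule zero_count_squares[OF holo D0 growth C])
      fix q assume "q \<in> (\<lambda>w. w\<^sup>2) ` T"
      then obtain w where w: "w \<in> T" "q = w\<^sup>2" by blast
      then have "D w = 0" "w \<noteq> 0" using W * D0 by auto
      then show "q \<noteq> 0 \<and> cmod q \<le> 1 - 2 * (\<delta> / 2) \<and> 8 * (s / 4) \<le> cmod (1 - q) \<and> (\<exists>w. w\<^sup>2 = q \<and> D w = 0)"
        using w *(7)[OF w(1)] by (auto simp: a_def b_def norm_power)
    qed (use * in auto)
    moreover have "real (card T) \<le> 2 * real (card ((\<lambda>w. w\<^sup>2) ` T))"
      using card_le_2_card_squares[OF *(5)] by linarith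
    ultimately show "real (card T) \<le> 32768 * C / (\<delta> ^ 3 * s)"
      by (simp add: power_divide)
  qed (use C \<tau> in auto)
  then have "(\<lambda>w. 2 powr (1 + \<tau>) * (a w powr (3 + \<tau>) * b w powr (1 + \<tau>))) summable_on W"
    by (rule summable_on_cmult_right)
  moreover have "2 powr (1 + \<tau>) * (a w powr (3 + \<tau>) * b w powr (1 + \<tau>)) =
      (1 - (cmod w)\<^sup>2) powr (3 + \<tau>) * (cmod (1 - w\<^sup>2)) powr (1 + \<tau>)" for w
    by (simp add: a_def b_def powr_divide)
  ultimately show ?thesis by simp
qed

section \<open>The sequence spaces and the resolvent of the discrete Laplacian\<close>

definition shift :: "int \<Rightarrow> bisequence \<Rightarrow> bisequence" where
  "shift j f = (\<lambda>n. f (n + j))"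

lemma exponent_ge_1:
  assumes "1 \<le> p" "p \<noteq> (\<infinity>::ennreal)"
  shows "1 \<le> enn2real p"
proof -
  have "p < \<infinity>" using assms by (simp add: less_top[symmetric])
  then show ?thesis using enn2real_mono[OF assms(1)] by simp
qed

lemma lp_shift:
  assumes "f \<in> lp p"
  shows "shift j f \<in> lp p"
proof (cases "p = \<infinity>")
  case True
  have "range (shift j f) \<subseteq> range f" by (auto simp: shift_def)
  then show ?thesis using True assms bounded_subset by (auto simp: lp_def)
next
  case False
  have "bij_betw (\<lambda>n. n + j) UNIV (UNIV :: int set)"
    by (rule bij_betwI[where g = "\<lambda>n. n - j"]) auto
  from summable_on_reindex_bij_betw[OF this, of "\<lambda>n. cmod (f n) powr enn2real p"]
  show ?thesis using False assms by (simp add: lp_def shift_def)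
qed

lemma lp_norm_shift: "lp_norm p (shift j f) = lp_norm p f"
proof -
  have bij: "bij_betw (\<lambda>n. n + j) UNIV (UNIV :: int set)"
    by (rule bij_betwI[where g = "\<lambda>n. n - j"]) auto
  have "range (\<lambda>n. cmod (f n)) = (\<lambda>n. cmod (f n)) ` range (\<lambda>n. n + j)"
    unfolding bij_betw_imp_surj_on[OF bij] ..
  also have "\<dots> = range (\<lambda>n. cmod (f (n + j)))"
    by (rule image_image)
  finally have "range (\<lambda>n. cmod (f (n + j))) = range (\<lambda>n. cmod (f n))" ..
  then show ?thesis
    using infsum_reindex_bij_betw[OF bij, of "\<lambda>n. cmod (f n) powr enn2real p"]
    by (simp add: lp_norm_def shift_def)
qed

text \<open>For finite exponent r, |a + b| is at most twice the larger modulus, so |a + b|^r is at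
  most 2^r (|a|^r + |b|^r).\<close>

lemma lp_add:
  assumes "1 \<le> p" "f \<in> lp p" "g \<in> lp p"
  shows "f + g \<in> lp p"
proof (cases "p = \<infinity>")
  case True
  then have "bounded (range f)" "bounded (range g)" using assms by (auto simp: lp_def)
  then obtain a b where "\<And>n. cmod (f n) \<le> a" "\<And>n. cmod (g n) \<le> b"
    by (auto simp: bounded_iff)
  then have "cmod ((f + g) n) \<le> a + b" for n
    using norm_triangle_ineq[of "f n" "g n"] by (smt (verit) plus_fun_apply)
  then show ?thesis using True by (auto simp: lp_def bounded_iff)
next
  case False
  define r where "r = enn2real p"
  have r: "1 \<le> r" using exponent_ge_1[OF assms(1) False] by (simp add: r_def)
  have "(\<lambda>n. cmod ((f + g) n) powr r) summable_on UNIV"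
  proof (rule summable_on_comparison_test)
    show "(\<lambda>n. 2 powr r * (cmod (f n) powr r + cmod (g n) powr r)) summable_on UNIV"
      using assms False by (intro summable_on_cmult_right summable_on_add) (auto simp: lp_def r_def)
    show "cmod ((f + g) n) powr r \<le> 2 powr r * (cmod (f n) powr r + cmod (g n) powr r)" for n
    proof -
      have "cmod ((f + g) n) \<le> 2 * max (cmod (f n)) (cmod (g n))"
        using norm_triangle_ineq[of "f n" "g n"] by (auto simp: max_def)
      then have "cmod ((f + g) n) powr r \<le> (2 * max (cmod (f n)) (cmod (g n))) powr r"
        using r by (intro powr_mono2) auto
      also have "\<dots> = 2 powr r * (max (cmod (f n)) (cmod (g n)) powr r)"
        by (simp add: powr_mult)
      also have "\<dots> \<le> 2 powr r * (cmod (f n) powr r + cmod (g n) powr r)"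
        by (intro mult_left_mono) (auto simp: max_def)
      finally show ?thesis .
    qed
  qed auto
  then show ?thesis using False by (simp add: lp_def r_def)
qed

lemma lp_scale:
  assumes "f \<in> lp p"
  shows "c *\<^sub>C f \<in> lp p"
proof (cases "p = \<infinity>")
  case True
  then obtain a where "\<And>n. cmod (f n) \<le> a" using assms by (auto simp: bounded_iff lp_def)
  then have "cmod (c * f n) \<le> cmod c * a" for n
    by (simp add: norm_mult mult_left_mono)
  then show ?thesis using True by (auto simp: lp_def bounded_iff scale_def)
next
  case False
  then have "(\<lambda>n. cmod c powr enn2real p * cmod (f n) powr enn2real p) summable_on UNIV"
    using assms by (intro summable_on_cmult_right) (simp add: lp_def)
  then show ?thesis using False by (simp add: lp_def scale_def norm_mult powr_mult)
qed

lemma lp_zero: "0 \<in> lp p"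
  by (auto simp: lp_def zero_fun_def)

lemma lp_sum:
  fixes f :: "nat \<Rightarrow> bisequence"
  assumes "1 \<le> p" "\<And>i. i < N \<Longrightarrow> f i \<in> lp p"
  shows "(\<Sum>i<N. f i) \<in> lp p"
  using assms(2) by (induction N) (auto intro: lp_zero lp_add[OF assms(1)])

lemma diff_eq_add_scale: "f - g = f + (-1) *\<^sub>C g"
  by (auto simp: scale_def)

lemma lp_diff:
  assumes "1 \<le> p" "f \<in> lp p" "g \<in> lp p"
  shows "f - g \<in> lp p"
  unfolding diff_eq_add_scale by (intro lp_add lp_scale assms)

lemma coordinate_le_lp_norm:
  assumes "1 \<le> p" "f \<in> lp p"
  shows "cmod (f n) \<le> lp_norm p f"
proof (cases "p = \<infinity>")
  case True
  then obtain a where "\<And>n. cmod (f n) \<le> a" using assms by (auto simp: bounded_iff lp_def)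
  then have "bdd_above (range (\<lambda>n. cmod (f n)))" by (intro bdd_aboveI2)
  then have "cmod (f n) \<le> (SUP n. cmod (f n))" by (intro cSUP_upper) auto
  then show ?thesis using True by (simp add: lp_norm_def)
next
  case False
  define r where "r = enn2real p"
  have r: "1 \<le> r" using exponent_ge_1[OF assms(1) False] by (simp add: r_def)
  have "cmod (f n) powr r \<le> (\<Sum>\<^sub>\<infinity>n. cmod (f n) powr r)"
    using finite_sum_le_infsum[of "\<lambda>n. cmod (f n) powr r" UNIV "{n}"] assms False
    by (simp add: lp_def r_def)
  then have "(cmod (f n) powr r) powr (1 / r) \<le> (\<Sum>\<^sub>\<infinity>n. cmod (f n) powr r) powr (1 / r)"
    using r by (intro powr_mono2) auto
  then show ?thesis using r False by (simp add: lp_norm_def powr_powr r_def)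
qed

lemma lp_norm_nonneg:
  assumes "1 \<le> p" "f \<in> lp p"
  shows "0 \<le> lp_norm p f"
  using coordinate_le_lp_norm[OF assms, of 0] norm_ge_zero order_trans by blast

lemma lp_norm_scale_le:
  assumes "1 \<le> p" "f \<in> lp p"
  shows "lp_norm p (c *\<^sub>C f) \<le> cmod c * lp_norm p f"
proof (cases "p = \<infinity>")
  case True
  have "(SUP n. cmod ((c *\<^sub>C f) n)) \<le> cmod c * lp_norm p f"
    using coordinate_le_lp_norm[OF assms]
    by (intro cSUP_least) (auto simp: scale_def norm_mult intro!: mult_left_mono)
  then show ?thesis using True by (simp add: lp_norm_def)
next
  case False
  define r where "r = enn2real p"
  have r: "1 \<le> r" using exponent_ge_1[OF assms(1) False] by (simp add: r_def)
  have "(\<Sum>\<^sub>\<infinity>n. cmod ((c *\<^sub>C f) n) powr r) = cmod c powr r * (\<Sum>\<^sub>\<infinity>n. cmod (f n) powr r)"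
    by (simp add: scale_def norm_mult powr_mult infsum_cmult_right')
  moreover have "0 \<le> (\<Sum>\<^sub>\<infinity>n. cmod (f n) powr r)"
    by (rule infsum_nonneg) simp
  ultimately show ?thesis
    using r False by (simp add: lp_norm_def powr_mult powr_powr flip: r_def)
qed

text \<open>The bound \<open>t\<close> is a parameter rather than the norm, so that explicit
  constants depending on the index and on \<open>w\<close> can be carried along.\<close>

definition bounded_functional :: "ennreal \<Rightarrow> real \<Rightarrow> (bisequence \<Rightarrow> complex) \<Rightarrow> bool" where
  "bounded_functional p t \<phi> \<longleftrightarrow>
     (\<forall>f\<in>lp p. \<forall>g\<in>lp p. \<phi> (f + g) = \<phi> f + \<phi> g) \<and>
     (\<forall>c. \<forall>f\<in>lp p. \<phi> (c *\<^sub>C f) = c * \<phi> f) \<and>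
     (\<forall>f\<in>lp p. cmod (\<phi> f) \<le> t * lp_norm p f)"

lemma
  assumes "bounded_functional p t \<phi>"
  shows bounded_functional_add: "f \<in> lp p \<Longrightarrow> g \<in> lp p \<Longrightarrow> \<phi> (f + g) = \<phi> f + \<phi> g"
    and bounded_functional_scale: "f \<in> lp p \<Longrightarrow> \<phi> (c *\<^sub>C f) = c * \<phi> f"
    and bounded_functional_le: "f \<in> lp p \<Longrightarrow> cmod (\<phi> f) \<le> t * lp_norm p f"
  using assms by (auto simp: bounded_functional_def)

lemma bounded_functional_diff:
  assumes "bounded_functional p t \<phi>" "f \<in> lp p" "g \<in> lp p"
  shows "\<phi> (f - g) = \<phi> f - \<phi> g"
  unfolding diff_eq_add_scale
  using bounded_functional_add[OF assms(1,2) lp_scale[OF assms(3)]] bounded_functional_scale[OF assms(1,3)]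
  by simp

lemma scale_zero_left: "0 *\<^sub>C f = 0"
  by (auto simp: scale_def)

lemma bounded_functional_zero:
  assumes "bounded_functional p t \<phi>"
  shows "\<phi> 0 = 0"
  using bounded_functional_scale[OF assms lp_zero, of 0] by (simp only: scale_zero_left mult_zero_left)

lemma bounded_functional_sum:
  fixes f :: "nat \<Rightarrow> bisequence"
  assumes "1 \<le> p" "bounded_functional p t \<phi>" "\<And>i. i < N \<Longrightarrow> f i \<in> lp p"
  shows "\<phi> (\<Sum>i<N. f i) = (\<Sum>i<N. \<phi> (f i))"
  using assms(3)
proof (induction N)
  case 0
  then show ?case
    using bounded_functional_zero[OF assms(2)] by (simp only: lessThan_0 sum.empty)
next
  case (Suc N)
  have "\<phi> (sum f {..<N} + f N) = \<phi> (sum f {..<N}) + \<phi> (f N)"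
    by (rule bounded_functional_add[OF assms(2) lp_sum[OF assms(1)]]) (use Suc.prems in auto)
  moreover have "\<phi> (sum f {..<N}) = (\<Sum>i<N. \<phi> (f i))"
    using Suc by simp
  ultimately show ?case by (simp only: sum.lessThan_Suc)
qed

lemma bounded_functional_coordinate:
  assumes "1 \<le> p"
  shows "bounded_functional p 1 (\<lambda>f. f n)"
  using coordinate_le_lp_norm[OF assms] by (simp add: bounded_functional_def scale_def)

text \<open>The supremum defining \<open>dual_norm\<close> is over a nonempty set that is bounded
  above, so it bounds every value on the unit ball; scaling extends this to all vectors of positive
  norm, and on vectors of norm 0 the functional vanishes.\<close>

lemma dual_norm_bound:
  assumes "1 \<le> p" "\<phi> \<in> dual p"
  shows "0 \<le> dual_norm p \<phi>" "bounded_functional p (dual_norm p \<phi>) \<phi>"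
proof -
  obtain C where C: "\<And>f. f \<in> lp p \<Longrightarrow> cmod (\<phi> f) \<le> C * lp_norm p f"
    using assms(2) unfolding dual_def by blast
  have "bdd_above ((\<lambda>f. cmod (\<phi> f)) ` {f \<in> lp p. lp_norm p f \<le> 1})"
  proof (rule bdd_aboveI[of _ "\<bar>C\<bar>"], safe)
    fix f assume f: "f \<in> lp p" "lp_norm p f \<le> 1"
    have "C * lp_norm p f \<le> \<bar>C\<bar> * 1"
      using f lp_norm_nonneg[OF assms(1) f(1)] by (intro mult_mono) auto
    then show "cmod (\<phi> f) \<le> \<bar>C\<bar>" using C[OF f(1)] by linarith
  qed
  then have upper: "cmod (\<phi> f) \<le> dual_norm p \<phi>" if "f \<in> lp p" "lp_norm p f \<le> 1" for f
    unfolding dual_norm_def using that by (intro cSUP_upper) auto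
  have "lp_norm p 0 \<le> 1"
    using lp_norm_scale_le[OF assms(1) lp_zero, of 0] unfolding scale_zero_left by simp
  then show "0 \<le> dual_norm p \<phi>"
    using upper[OF lp_zero] norm_ge_zero order_trans by blast
  have "cmod (\<phi> f) \<le> dual_norm p \<phi> * lp_norm p f" if f: "f \<in> lp p" for f
  proof (cases "lp_norm p f = 0")
    case True
    then show ?thesis using C[OF f] by simp
  next
    case False
    then have pos: "0 < lp_norm p f" using lp_norm_nonneg[OF assms(1) f] by simp
    let ?c = "complex_of_real (1 / lp_norm p f)"
    have "lp_norm p (?c *\<^sub>C f) \<le> 1"
      using lp_norm_scale_le[OF assms(1) f, of ?c] pos by (simp add: norm_divide)
    then have "cmod (\<phi> (?c *\<^sub>C f)) \<le> dual_norm p \<phi>"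
      by (rule upper[OF lp_scale[OF f]])
    moreover have "\<phi> (?c *\<^sub>C f) = ?c * \<phi> f"
      using assms(2) f by (simp add: dual_def)
    moreover have "cmod (?c * \<phi> f) = cmod (\<phi> f) / lp_norm p f"
      using pos by (simp add: norm_mult norm_divide)
    ultimately have "cmod (\<phi> f) / lp_norm p f \<le> dual_norm p \<phi>" by (simp only:)
    then show ?thesis using pos by (simp add: pos_divide_le_eq)
  qed
  then show "bounded_functional p (dual_norm p \<phi>) \<phi>"
    using assms(2) by (simp add: bounded_functional_def dual_def)
qed

text \<open>Only the product of the two norms in each term is summable. Moving a scalar from one
  factor to the other gives both the bound s_n, the square root of that product, without changing
  the terms of the series.\<close>

lemma nuclear_op_rescaled:
  assumes "1 \<le> p" "nuclear_op p K"
  obtains f s \<phi> where "\<And>n::nat. f n \<in> lp p" "\<And>n. lp_norm p (f n) \<le> s n"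
    "\<And>n. bounded_functional p (s n) (\<phi> n)" "\<And>n. 0 \<le> s n" "summable (\<lambda>n. (s n)\<^sup>2)"
    "\<And>g. g \<in> lp p \<Longrightarrow> (\<lambda>N. lp_norm p (K g - (\<Sum>n<N. \<phi> n g *\<^sub>C f n))) \<longlonglongrightarrow> 0"
proof -
  obtain f :: "nat \<Rightarrow> bisequence" and \<phi> where f: "\<And>n. f n \<in> lp p" and \<phi>: "\<And>n. \<phi> n \<in> dual p"
    and lim: "\<And>g. g \<in> lp p \<Longrightarrow> (\<lambda>N. lp_norm p (K g - (\<Sum>n<N. \<phi> n g *\<^sub>C f n))) \<longlonglongrightarrow> 0"
    and summ: "summable (\<lambda>n. dual_norm p (\<phi> n) * lp_norm p (f n))"
    using assms(2) unfolding nuclear_op_def by blast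
  define \<alpha> where "\<alpha> n = dual_norm p (\<phi> n)" for n
  define \<beta> where "\<beta> n = lp_norm p (f n)" for n
  define s where "s n = sqrt (\<alpha> n * \<beta> n)" for n
  have \<alpha>: "0 \<le> \<alpha> n" "bounded_functional p (\<alpha> n) (\<phi> n)" for n
    using dual_norm_bound[OF assms(1) \<phi>] by (auto simp: \<alpha>_def)
  have \<beta>: "0 \<le> \<beta> n" for n
    using lp_norm_nonneg[OF assms(1) f] by (simp add: \<beta>_def)
  have s: "0 \<le> s n" "(s n)\<^sup>2 = \<alpha> n * \<beta> n" for n
    using \<alpha> \<beta> by (simp_all add: s_def)
  \<comment> \<open>If either norm is 0, then \<open>s n = 0\<close> and both rescaled factors
    become 0, also where division by 0 occurs; the original term is 0 as well in that case.\<close>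
  define f' where "f' n = complex_of_real (s n / \<beta> n) *\<^sub>C f n" for n
  define \<phi>' where "\<phi>' n g = complex_of_real (s n / \<alpha> n) * \<phi> n g" for n g
  show ?thesis
  proof (rule that[of f' s \<phi>'])
    show "f' n \<in> lp p" for n unfolding f'_def by (rule lp_scale[OF f])
    show "lp_norm p (f' n) \<le> s n" for n
    proof -
      have "lp_norm p (f' n) \<le> s n / \<beta> n * \<beta> n"
        using lp_norm_scale_le[OF assms(1) f, of "complex_of_real (s n / \<beta> n)" n] s(1)[of n] \<beta>[of n]
        unfolding f'_def norm_of_real \<beta>_def[symmetric] by simp
      then show ?thesis using s(1)[of n] by (cases "\<beta> n = 0") auto
    qed
    show "bounded_functional p (s n) (\<phi>' n)" for n
    proof -
      have "cmod (\<phi>' n g) \<le> s n * lp_norm p g" if g: "g \<in> lp p" for g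
      proof -
        have "cmod (\<phi>' n g) = s n / \<alpha> n * cmod (\<phi> n g)"
          using s(1)[of n] \<alpha>(1)[of n] by (simp add: \<phi>'_def norm_mult norm_divide)
        also have "\<dots> \<le> s n / \<alpha> n * (\<alpha> n * lp_norm p g)"
          using s(1)[of n] \<alpha>(1)[of n] bounded_functional_le[OF \<alpha>(2) g] by (intro mult_left_mono) auto
        also have "\<dots> \<le> s n * lp_norm p g"
          using s(1)[of n] lp_norm_nonneg[OF assms(1) g] by (cases "\<alpha> n = 0") auto
        finally show ?thesis .
      qed
      moreover have "\<phi>' n (g + h) = \<phi>' n g + \<phi>' n h" if "g \<in> lp p" "h \<in> lp p" for g h
        unfolding \<phi>'_def using bounded_functional_add[OF \<alpha>(2) that] by (simp only: distrib_left)
      moreover have "\<phi>' n (c *\<^sub>C g) = c * \<phi>' n g" if "g \<in> lp p" for c g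
        unfolding \<phi>'_def using bounded_functional_scale[OF \<alpha>(2) that] by (simp only: mult.left_commute)
      ultimately show ?thesis unfolding bounded_functional_def by blast
    qed
    show "0 \<le> s n" for n by (rule s)
    show "summable (\<lambda>n. (s n)\<^sup>2)" using summ by (simp add: s(2) \<alpha>_def \<beta>_def)
    show "(\<lambda>N. lp_norm p (K g - (\<Sum>n<N. \<phi>' n g *\<^sub>C f' n))) \<longlonglongrightarrow> 0" if g: "g \<in> lp p" for g
    proof -
      have "\<phi>' n g *\<^sub>C f' n = \<phi> n g *\<^sub>C f n" for n
      proof (cases "\<alpha> n = 0 \<or> \<beta> n = 0")
        case True
        then have "\<phi> n g = 0 \<or> f n = 0"
        proof
          assume "\<alpha> n = 0"
          then show ?thesis using bounded_functional_le[OF \<alpha>(2) g, of n] by simp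
        next
          assume "\<beta> n = 0"
          then have "f n i = 0" for i
            using coordinate_le_lp_norm[OF assms(1) f, of n i] by (simp add: \<beta>_def)
          then show ?thesis by auto
        qed
        then show ?thesis by (auto simp: \<phi>'_def f'_def scale_def)
      next
        case False
        have "complex_of_real (s n / \<alpha> n) * complex_of_real (s n / \<beta> n) = complex_of_real ((s n)\<^sup>2 / (\<alpha> n * \<beta> n))"
          by (simp add: power2_eq_square)
        also have "\<dots> = 1" using False by (simp add: s(2))
        finally have c: "complex_of_real (s n / \<alpha> n) * complex_of_real (s n / \<beta> n) = 1" .
        have "\<phi>' n g * (complex_of_real (s n / \<beta> n) * x) = \<phi> n g * x" for x
        proof -
          have "\<phi>' n g * (complex_of_real (s n / \<beta> n) * x) = (complex_of_real (s n / \<alpha> n) * complex_of_real (s n / \<beta> n)) * (\<phi> n g * x)"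
            unfolding \<phi>'_def by (simp only: mult_ac)
          then show ?thesis unfolding c by simp
        qed
        then show ?thesis by (simp only: f'_def scale_def)
      qed
      then show ?thesis using lim[OF g] by (simp only:)
    qed
  qed
qed

section \<open>The resolvent kernel tested against functionals\<close>

definition kernel_coeff :: "(bisequence \<Rightarrow> complex) \<Rightarrow> bisequence \<Rightarrow> nat \<Rightarrow> complex" where
  "kernel_coeff \<phi> h k = (if k = 0 then \<phi> h else \<phi> (shift (int k) h) + \<phi> (shift (- int k) h))"

text \<open>This is \<phi> applied to the sum of w^|j| \<open>shift j h\<close> over all integers j,
  with j and -j grouped into one power of \<open>w\<close>. Applying \<phi> before summing makes it
  a scalar power series. Multiplied by w / (1 - w^2) it represents \<phi> of the resolvent of the
  Laplacian at w + 1/w applied to \<open>h\<close>.\<close>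

definition kernel_sum :: "(bisequence \<Rightarrow> complex) \<Rightarrow> complex \<Rightarrow> bisequence \<Rightarrow> complex" where
  "kernel_sum \<phi> w h = (\<Sum>k. kernel_coeff \<phi> h k * w ^ k)"

lemma kernel_coeff_le:
  assumes "1 \<le> p" "bounded_functional p t \<phi>" "h \<in> lp p"
  shows "cmod (kernel_coeff \<phi> h k) \<le> 2 * (t * lp_norm p h)"
proof -
  have *: "cmod (\<phi> (shift j h)) \<le> t * lp_norm p h" for j
    using bounded_functional_le[OF assms(2) lp_shift[OF assms(3)], of j] by (simp only: lp_norm_shift)
  have **: "cmod (\<phi> h) \<le> t * lp_norm p h"
    by (rule bounded_functional_le[OF assms(2,3)])
  have "0 \<le> t * lp_norm p h" using ** norm_ge_zero order_trans by blast
  then show ?thesis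
    using ** *[of "int k"] *[of "- int k"] norm_triangle_ineq[of "\<phi> (shift (int k) h)" "\<phi> (shift (- int k) h)"]
    unfolding kernel_coeff_def by (cases "k = 0") auto
qed

lemma kernel_sum_summable:
  assumes "1 \<le> p" "bounded_functional p t \<phi>" "h \<in> lp p" "cmod w < 1"
  shows "summable (\<lambda>k. kernel_coeff \<phi> h k * w ^ k)"
    "cmod (kernel_sum \<phi> w h) \<le> 2 / (1 - cmod w) * t * lp_norm p h"
proof -
  let ?B = "2 * (t * lp_norm p h)"
  have le: "norm (kernel_coeff \<phi> h k * w ^ k) \<le> ?B * cmod w ^ k" for k
    unfolding norm_mult norm_power
    using kernel_coeff_le[OF assms(1-3)] by (rule mult_right_mono) simp
  have geo: "(\<lambda>k. ?B * cmod w ^ k) sums (?B * (1 / (1 - cmod w)))"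
    using geometric_sums[of "cmod w"] assms(4) by (intro sums_mult) simp
  then have "summable (\<lambda>k. ?B * cmod w ^ k)" by (rule sums_summable)
  then show 1: "summable (\<lambda>k. kernel_coeff \<phi> h k * w ^ k)"
    by (rule summable_comparison_test'[where N = 0]) (rule le)
  have "cmod (kernel_sum \<phi> w h) \<le> (\<Sum>k. ?B * cmod w ^ k)"
    unfolding kernel_sum_def by (rule norm_suminf_le[OF le sums_summable[OF geo]])
  also have "\<dots> = ?B * (1 / (1 - cmod w))"
    by (rule sums_unique[OF geo, symmetric])
  finally show "cmod (kernel_sum \<phi> w h) \<le> 2 / (1 - cmod w) * t * lp_norm p h"
    by (simp add: mult_ac)
qed

text \<open>Allows \<open>kernel_sum \<phi> w\<close> to be applied termwise to the series of the
  nuclear operator: linearity treats the partial sums, the bound treats the remainder.\<close>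

lemma bounded_functional_kernel_sum:
  assumes "1 \<le> p" "bounded_functional p t \<phi>" "cmod w < 1"
  shows "bounded_functional p (2 / (1 - cmod w) * t) (kernel_sum \<phi> w)"
proof -
  have "kernel_sum \<phi> w (f + g) = kernel_sum \<phi> w f + kernel_sum \<phi> w g" if fg: "f \<in> lp p" "g \<in> lp p" for f g
  proof -
    have "\<phi> (shift j (f + g)) = \<phi> (shift j f) + \<phi> (shift j g)" for j
    proof -
      have "shift j (f + g) = shift j f + shift j g" by (auto simp: shift_def)
      then show ?thesis using bounded_functional_add[OF assms(2) lp_shift[OF fg(1)] lp_shift[OF fg(2)]] by (simp only:)
    qed
    then have "kernel_coeff \<phi> (f + g) k = kernel_coeff \<phi> f k + kernel_coeff \<phi> g k" for k
      unfolding kernel_coeff_def using bounded_functional_add[OF assms(2) fg] by (simp only: add_ac if_cancel split: if_split) (auto simp: add_ac)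
    then show ?thesis
      unfolding kernel_sum_def
      by (simp only: distrib_right suminf_add[OF kernel_sum_summable(1)[OF assms(1,2) fg(1) assms(3)] kernel_sum_summable(1)[OF assms(1,2) fg(2) assms(3)]])
  qed
  moreover have "kernel_sum \<phi> w (c *\<^sub>C f) = c * kernel_sum \<phi> w f" if f: "f \<in> lp p" for c f
  proof -
    have "\<phi> (shift j (c *\<^sub>C f)) = c * \<phi> (shift j f)" for j
    proof -
      have "shift j (c *\<^sub>C f) = c *\<^sub>C shift j f" by (simp add: shift_def scale_def)
      then show ?thesis using bounded_functional_scale[OF assms(2) lp_shift[OF f]] by (simp only:)
    qed
    then have "kernel_coeff \<phi> (c *\<^sub>C f) k = c * kernel_coeff \<phi> f k" for k
      unfolding kernel_coeff_def using bounded_functional_scale[OF assms(2) f] by (simp add: distrib_left)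
    then show ?thesis
      unfolding kernel_sum_def
      by (simp only: mult.assoc suminf_mult[OF kernel_sum_summable(1)[OF assms(1,2) f assms(3)]])
  qed
  ultimately show ?thesis
    using kernel_sum_summable(2)[OF assms(1,2) _ assms(3)] unfolding bounded_functional_def by blast
qed

lemma kernel_sum_holomorphic:
  assumes "1 \<le> p" "bounded_functional p t \<phi>" "h \<in> lp p"
  shows "(\<lambda>w. kernel_sum \<phi> w h) holomorphic_on ball 0 1"
proof (rule power_series_holomorphic)
  fix w :: complex assume "w \<in> ball 0 1"
  then show "(\<lambda>n. kernel_coeff \<phi> h n * (w - 0) ^ n) sums kernel_sum \<phi> w h"
    using kernel_sum_summable(1)[OF assms, of w] unfolding kernel_sum_def by (simp add: summable_sums)
qed

text \<open>Applying the partial sums of the resolvent kernel to \<open>h = (\<lambda> - \<Delta>) g\<close> telescopes.\<close>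

lemma kernel_sum_eq:
  assumes "1 \<le> p" "bounded_functional p t \<phi>" "g \<in> lp p" "h \<in> lp p" "cmod w < 1" "w \<noteq> 0"
    and eq: "\<And>n. h n = (w + 1 / w) * g n - g (n - 1) - g (n + 1)"
  shows "kernel_sum \<phi> w h = (1 / w - w) * \<phi> g"
proof -
  define \<gamma> where "\<gamma> j = \<phi> (shift j g)" for j
  have \<gamma>0: "\<gamma> 0 = \<phi> g" by (simp add: \<gamma>_def shift_def)
  have \<gamma>le: "cmod (\<gamma> j) \<le> t * lp_norm p g" for j
    unfolding \<gamma>_def
    using bounded_functional_le[OF assms(2) lp_shift[OF assms(3)], of j] by (simp only: lp_norm_shift)
  have \<phi>h: "\<phi> (shift j h) = (w + 1 / w) * \<gamma> j - \<gamma> (j - 1) - \<gamma> (j + 1)" for j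
  proof -
    have e: "shift j h = (w + 1 / w) *\<^sub>C shift j g - shift (j - 1) g - shift (j + 1) g"
      unfolding shift_def scale_def eq by (auto simp: algebra_simps)
    show ?thesis
      unfolding e \<gamma>_def
      using assms(3) by (simp only: bounded_functional_diff[OF assms(2)] bounded_functional_scale[OF assms(2)]
          lp_shift lp_scale lp_diff[OF assms(1)])
  qed
  have c0: "kernel_coeff \<phi> h 0 = (w + 1 / w) * \<gamma> 0 - \<gamma> (- 1) - \<gamma> 1"
    using \<phi>h[of 0] by (simp add: kernel_coeff_def shift_def)
  have cS: "kernel_coeff \<phi> h (Suc k) = (w + 1 / w) * (\<gamma> (int k + 1) + \<gamma> (- int k - 1))
      - (\<gamma> (int k) + \<gamma> (- int k)) - (\<gamma> (int k + 2) + \<gamma> (- int k - 2))" for k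
  proof -
    have 1: "kernel_coeff \<phi> h (Suc k) = \<phi> (shift (int k + 1) h) + \<phi> (shift (- int k - 1) h)"
    proof -
      have "int (Suc k) = int k + 1" "- int (Suc k) = - int k - 1" by simp_all
      then show ?thesis by (simp only: kernel_coeff_def nat.distinct if_False)
    qed
    have 2: "int k + 1 - 1 = int k" "int k + 1 + 1 = int k + 2"
      "- int k - 1 - 1 = - int k - 2" "- int k - 1 + 1 = - int k"
      by simp_all
    have ring: "(c * a - x - y) + (c * b - y' - x') = c * (a + b) - (x + x') - (y + y')"
      for a b c x x' y y' :: complex
      by (simp add: algebra_simps)
    show ?thesis
      unfolding 1 \<phi>h 2 by (rule ring)
  qed
  \<comment> \<open>After telescoping, only the central term and boundary terms at distance
    \<open>J\<close> and \<open>J + 1\<close> from it survive.\<close>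
  have part: "(\<Sum>k<Suc J. kernel_coeff \<phi> h k * w ^ k) = (1 / w - w) * \<gamma> 0
      + w ^ Suc J * (\<gamma> (int J) + \<gamma> (- int J)) - w ^ J * (\<gamma> (int J + 1) + \<gamma> (- int J - 1))" for J
  proof (induction J)
    case 0
    show ?case by (simp add: c0 algebra_simps)
  next
    case (Suc J)
    have "(\<Sum>k<Suc (Suc J). kernel_coeff \<phi> h k * w ^ k) =
       (\<Sum>k<Suc J. kernel_coeff \<phi> h k * w ^ k) + kernel_coeff \<phi> h (Suc J) * w ^ Suc J"
      by (rule sum.lessThan_Suc)
    also have "\<dots> = (1 / w - w) * \<gamma> 0
      + w ^ Suc (Suc J) * (\<gamma> (int J + 1) + \<gamma> (- int J - 1)) - w ^ Suc J * (\<gamma> (int J + 2) + \<gamma> (- int J - 2))"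
      unfolding Suc.IH cS using assms(6) by (simp add: field_simps)
    finally have *: "(\<Sum>k<Suc (Suc J). kernel_coeff \<phi> h k * w ^ k) = (1 / w - w) * \<gamma> 0
      + w ^ Suc (Suc J) * (\<gamma> (int J + 1) + \<gamma> (- int J - 1)) - w ^ Suc J * (\<gamma> (int J + 2) + \<gamma> (- int J - 2))" .
    have i: "int (Suc J) = int J + 1" "- (int J + 1) = - int J - 1" "int J + 1 + 1 = int J + 2"
      "- int J - 1 - 1 = - int J - 2"
      by simp_all
    show ?case unfolding i by (rule *)
  qed
  \<comment> \<open>The offset \<open>m\<close> covers both boundary terms, with
    \<open>m = 1\<close> and \<open>m = 0\<close>; the values of \<gamma> are bounded because shifts
    preserve the norm.\<close>
  have tail: "(\<lambda>J. w ^ (J + m) * (\<gamma> (a J) + \<gamma> (b J))) \<longlonglongrightarrow> 0" for m :: nat and a b :: "nat \<Rightarrow> int"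
  proof (rule Lim_null_comparison)
    have "cmod (\<gamma> (a J) + \<gamma> (b J)) \<le> 2 * (t * lp_norm p g)" for J
      using norm_triangle_ineq[of "\<gamma> (a J)" "\<gamma> (b J)"] \<gamma>le[of "a J"] \<gamma>le[of "b J"] by linarith
    then have "cmod (w ^ (J + m) * (\<gamma> (a J) + \<gamma> (b J))) \<le> cmod w ^ (J + m) * (2 * (t * lp_norm p g))" for J
      unfolding norm_mult norm_power by (rule mult_left_mono) simp
    then show "\<forall>\<^sub>F J in sequentially. cmod (w ^ (J + m) * (\<gamma> (a J) + \<gamma> (b J))) \<le> cmod w ^ (J + m) * (2 * (t * lp_norm p g))"
      by simp
    have "(\<lambda>J. cmod w ^ (J + m)) \<longlonglongrightarrow> 0"
      by (rule LIMSEQ_ignore_initial_segment) (rule LIMSEQ_realpow_zero, use assms(5) in auto)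
    then show "(\<lambda>J. cmod w ^ (J + m) * (2 * (t * lp_norm p g))) \<longlonglongrightarrow> 0"
      by (rule tendsto_mult_left_zero)
  qed
  have "(\<lambda>J. \<Sum>k<Suc J. kernel_coeff \<phi> h k * w ^ k) \<longlonglongrightarrow> (1 / w - w) * \<gamma> 0 + 0 - 0"
    unfolding part
    using tail[of 1 "\<lambda>J. int J" "\<lambda>J. - int J"] tail[of 0 "\<lambda>J. int J + 1" "\<lambda>J. - int J - 1"]
    by (intro tendsto_intros) (simp_all only: add_0_right Suc_eq_plus1)
  moreover have "(\<lambda>J. \<Sum>k<Suc J. kernel_coeff \<phi> h k * w ^ k) \<longlonglongrightarrow> kernel_sum \<phi> w h"
    unfolding kernel_sum_def
    by (rule LIMSEQ_Suc) (rule summable_LIMSEQ[OF kernel_sum_summable(1)[OF assms(1,2,4,5)]])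
  ultimately show ?thesis
    using LIMSEQ_unique unfolding \<gamma>0 by fastforce
qed

section \<open>Hadamard's inequality and determinants of finite sections\<close>

definition cdot :: "nat \<Rightarrow> (nat \<Rightarrow> complex) \<Rightarrow> (nat \<Rightarrow> complex) \<Rightarrow> complex" where
  "cdot n u v = (\<Sum>j<n. u j * cnj (v j))"

definition sqnorm :: "nat \<Rightarrow> (nat \<Rightarrow> complex) \<Rightarrow> real" where
  "sqnorm n u = (\<Sum>j<n. (cmod (u j))\<^sup>2)"

lemma cdot_self: "cdot n u u = complex_of_real (sqnorm n u)"
  by (simp add: cdot_def sqnorm_def complex_norm_square del: of_real_power)

lemma cdot_commute: "cdot n u v = cnj (cdot n v u)"
  by (simp add: cdot_def mult.commute)

lemma cdot_add_scale_left: "cdot n (\<lambda>j. u j + c * v j) w = cdot n u w + c * cdot n v w"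
  by (simp add: cdot_def distrib_right sum.distrib sum_distrib_left mult.assoc)

lemma sqnorm_nonneg: "0 \<le> sqnorm n u"
  by (simp add: sqnorm_def sum_nonneg)

lemma cdot_add_scale_right: "cdot n w (\<lambda>j. u j + c * v j) = cdot n w u + cnj c * cdot n w v"
  by (simp add: cdot_def distrib_left sum.distrib sum_distrib_left mult_ac)

lemma subtract_projection:
  fixes n :: nat and u v :: "nat \<Rightarrow> complex"
  obtains c where "cdot n (\<lambda>j. u j + c * v j) v = 0" "sqnorm n (\<lambda>j. u j + c * v j) \<le> sqnorm n u"
proof -
  \<comment> \<open>If \<open>v\<close> vanishes on the first \<open>n\<close> places, division by 0
    makes \<open>c = 0\<close>, and orthogonality to \<open>v\<close> is trivial.\<close>
  define c where "c = - (cdot n u v / cdot n v v)"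
  define w where "w = (\<lambda>j. u j + c * v j)"
  have left: "cdot n w x = cdot n u x + c * cdot n v x" for x
    unfolding w_def by (rule cdot_add_scale_left)
  have right: "cdot n x w = cdot n x u + cnj c * cdot n x v" for x
    unfolding w_def by (rule cdot_add_scale_right)
  have orth: "cdot n w v = 0"
  proof (cases "cdot n v v = 0")
    case True
    then have "sqnorm n v = 0" by (simp only: cdot_self of_real_eq_0_iff)
    then have "v j = 0" if "j < n" for j
      using that by (simp add: sqnorm_def sum_nonneg_eq_0_iff)
    then show ?thesis by (simp add: cdot_def)
  next
    case False
    then show ?thesis by (simp add: left c_def)
  qed
  have "complex_of_real (sqnorm n w) = cdot n w u"
    using right[of w] orth by (simp add: cdot_self)
  also have "\<dots> = cdot n u u - cdot n u v * cnj (cdot n u v) / cdot n v v"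
    unfolding left cdot_commute[of n v u] by (simp add: c_def)
  also have "\<dots> = complex_of_real (sqnorm n u - (cmod (cdot n u v))\<^sup>2 / sqnorm n v)"
    unfolding cdot_self complex_norm_square[symmetric] by simp
  finally have "sqnorm n w = sqnorm n u - (cmod (cdot n u v))\<^sup>2 / sqnorm n v"
    unfolding of_real_eq_iff .
  then have "sqnorm n w \<le> sqnorm n u"
    using sqnorm_nonneg[of n v] by simp
  with orth show ?thesis
    unfolding w_def by (rule that)
qed

abbreviation sq_mat :: "nat \<Rightarrow> (nat \<Rightarrow> nat \<Rightarrow> complex) \<Rightarrow> complex mat" where
  "sq_mat n a \<equiv> mat n n (\<lambda>(i, j). a i j)"

lemma det_row_operation:
  assumes "k < n" "l < n" "k \<noteq> l"
  shows "Determinant.det (sq_mat n (a(k := (\<lambda>j. a k j + c * a l j)))) = Determinant.det (sq_mat n a)"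
proof -
  have "sq_mat n (a(k := (\<lambda>j. a k j + c * a l j))) = addrow c k l (sq_mat n a)"
    by (rule eq_matI) (use assms in \<open>auto simp: add.commute\<close>)
  then show ?thesis
    using det_addrow[OF assms(2,3), of "sq_mat n a" c] by simp
qed

text \<open>One Gram-Schmidt sweep by determinant-preserving row operations. Subtracting the
  projection on row \<open>l\<close> keeps the orthogonality to earlier rows because those rows are
  already orthogonal to row \<open>l\<close>, and it does not increase the norm.\<close>

lemma orthogonalize_row:
  assumes "k < n" "\<And>i j. i < k \<Longrightarrow> j < i \<Longrightarrow> cdot n (b i) (b j) = 0" "l \<le> k"
  shows "\<exists>u. Determinant.det (sq_mat n (b(k := u))) = Determinant.det (sq_mat n b) \<and>
      sqnorm n u \<le> sqnorm n (b k) \<and> (\<forall>j<l. cdot n u (b j) = 0)"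
  using assms(3)
proof (induction l)
  case 0
  show ?case by (intro exI[of _ "b k"]) simp
next
  case (Suc l)
  then obtain u where u: "Determinant.det (sq_mat n (b(k := u))) = Determinant.det (sq_mat n b)"
    "sqnorm n u \<le> sqnorm n (b k)" "\<And>j. j < l \<Longrightarrow> cdot n u (b j) = 0"
    by auto
  obtain c where c: "cdot n (\<lambda>j. u j + c * b l j) (b l) = 0" "sqnorm n (\<lambda>j. u j + c * b l j) \<le> sqnorm n u"
    by (rule subtract_projection)
  define u' where "u' = (\<lambda>j. u j + c * b l j)"
  have "cdot n u' (b j) = 0" if "j < Suc l" for j
  proof (cases "j = l")
    case False
    then have "cdot n u (b j) = 0" "cdot n (b l) (b j) = 0"
      using that u(3) assms(2)[of l j] Suc.prems by auto
    then show ?thesis unfolding u'_def cdot_add_scale_left by simp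
  qed (simp add: u'_def c)
  moreover have "sqnorm n u' \<le> sqnorm n (b k)"
    using c(2) u(2) unfolding u'_def by linarith
  moreover have "Determinant.det (sq_mat n (b(k := u'))) = Determinant.det (sq_mat n b)"
    using det_row_operation[of k n l "b(k := u)" c] assms(1) Suc.prems u(1)
    by (simp add: u'_def fun_upd_upd)
  ultimately show ?case by blast
qed

lemma orthogonalize_rows:
  assumes "k \<le> n"
  shows "\<exists>b. Determinant.det (sq_mat n b) = Determinant.det (sq_mat n a) \<and>
     (\<forall>i<n. sqnorm n (b i) \<le> sqnorm n (a i)) \<and> (\<forall>i<k. \<forall>j<i. cdot n (b i) (b j) = 0)"
  using assms
proof (induction k)
  case 0
  show ?case by (intro exI[of _ a]) simp
next
  case (Suc k)
  then obtain b where b: "Determinant.det (sq_mat n b) = Determinant.det (sq_mat n a)"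
    "\<And>i. i < n \<Longrightarrow> sqnorm n (b i) \<le> sqnorm n (a i)" "\<And>i j. i < k \<Longrightarrow> j < i \<Longrightarrow> cdot n (b i) (b j) = 0"
    by auto
  obtain u where u: "Determinant.det (sq_mat n (b(k := u))) = Determinant.det (sq_mat n b)"
      "sqnorm n u \<le> sqnorm n (b k)" "\<And>j. j < k \<Longrightarrow> cdot n u (b j) = 0"
    using orthogonalize_row[of k n b k] b(3) Suc.prems by auto
  show ?case
  proof (intro exI[of _ "b(k := u)"] conjI allI impI)
    show "Determinant.det (sq_mat n (b(k := u))) = Determinant.det (sq_mat n a)"
      using u(1) b(1) by simp
    show "sqnorm n ((b(k := u)) i) \<le> sqnorm n (a i)" if "i < n" for i
      using b(2)[OF that] u(2) by auto
    show "cdot n ((b(k := u)) i) ((b(k := u)) j) = 0" if "i < Suc k" "j < i" for i j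
      using that b(3) u(3) by (cases "i = k") auto
  qed
qed

text \<open>Gram-Schmidt without normalisation keeps the determinant and does not lengthen the rows.
  The product of the resulting matrix with its adjoint is then triangular with the squared row norms
  on the diagonal, and its determinant is the squared modulus of the original one.\<close>

theorem hadamard_inequality:
  "(cmod (Determinant.det (sq_mat n a)))\<^sup>2 \<le> (\<Prod>i<n. sqnorm n (a i))"
proof -
  obtain b where b: "Determinant.det (sq_mat n b) = Determinant.det (sq_mat n a)"
    "\<And>i. i < n \<Longrightarrow> sqnorm n (b i) \<le> sqnorm n (a i)" "\<And>i j. i < n \<Longrightarrow> j < i \<Longrightarrow> cdot n (b i) (b j) = 0"
    using orthogonalize_rows[of n n a] by auto
  interpret cnj: comm_ring_hom cnj
    by unfold_locales auto
  define B where "B = sq_mat n b"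
  define G where "G = B * transpose_mat (map_mat cnj B)"
  have B: "B \<in> carrier_mat n n" by (simp add: B_def)
  then have G: "G \<in> carrier_mat n n" by (simp add: G_def)
  have entry: "G $$ (i, j) = cdot n (b i) (b j)" if "i < n" "j < n" for i j
    using that by (simp add: G_def B_def scalar_prod_def cdot_def atLeast0LessThan)
  have "upper_triangular G"
    using G b(3) entry by (auto simp: upper_triangular_def)
  then have "Determinant.det G = prod_list (diag_mat G)"
    using G by (rule det_upper_triangular)
  also have "\<dots> = (\<Prod>i<n. G $$ (i, i))"
    using G by (simp add: prod_list_diag_prod atLeast0LessThan)
  also have "\<dots> = (\<Prod>i<n. complex_of_real (sqnorm n (b i)))"
    by (intro prod.cong) (auto simp: entry cdot_self)
  finally have 1: "Determinant.det G = complex_of_real (\<Prod>i<n. sqnorm n (b i))"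
    by simp
  have "Determinant.det G = Determinant.det B * Determinant.det (transpose_mat (map_mat cnj B))"
    unfolding G_def by (rule det_mult) (use B in auto)
  also have "Determinant.det (transpose_mat (map_mat cnj B)) = cnj (Determinant.det B)"
    using B by (subst Determinant.det_transpose[of _ n]) auto
  also have "Determinant.det B * cnj (Determinant.det B) = complex_of_real ((cmod (Determinant.det B))\<^sup>2)"
    by (rule complex_norm_square[symmetric])
  finally have "(cmod (Determinant.det B))\<^sup>2 = (\<Prod>i<n. sqnorm n (b i))"
    using 1 of_real_eq_iff by metis
  also have "\<dots> \<le> (\<Prod>i<n. sqnorm n (a i))"
    using b(2) by (intro prod_mono) (auto simp: sqnorm_nonneg)
  finally show ?thesis by (simp add: B_def b(1))
qed

lemma hadamard_inequality_columns:
  "cmod (Determinant.det (sq_mat n a)) \<le> sqrt (\<Prod>j<n. \<Sum>i<n. (cmod (a i j))\<^sup>2)"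
proof -
  have "transpose_mat (sq_mat n a) = sq_mat n (\<lambda>i j. a j i)"
    by (rule eq_matI) auto
  then have "Determinant.det (sq_mat n a) = Determinant.det (sq_mat n (\<lambda>i j. a j i))"
    using Determinant.det_transpose[of "sq_mat n a" n] by simp
  then show ?thesis
    using hadamard_inequality[of n "\<lambda>i j. a j i"] by (simp add: sqnorm_def real_le_rsqrt)
qed

section \<open>Determinants of the finite sections of an infinite matrix\<close>

lemma det_sq_mat:
  "Determinant.det (sq_mat n b) = (\<Sum>q | q permutes {0..<n}. signof q * (\<Prod>i = 0..<n. b i (q i)))"
proof -
  have "Determinant.det (sq_mat n b) = (\<Sum>q | q permutes {0..<n}. signof q * (\<Prod>i = 0..<n. sq_mat n b $$ (i, q i)))"
    by (rule det_def') simp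
  also have "\<dots> = (\<Sum>q | q permutes {0..<n}. signof q * (\<Prod>i = 0..<n. b i (q i)))"
  proof (rule sum.cong[OF refl])
    fix q assume "q \<in> {q. q permutes {0..<n}}"
    then have "q i < n" if "i < n" for i
      using that permutes_in_image[of q "{0..<n}" i] by simp
    then have "(\<Prod>i = 0..<n. sq_mat n b $$ (i, q i)) = (\<Prod>i = 0..<n. b i (q i))"
      by (intro prod.cong) auto
    then show "signof q * (\<Prod>i = 0..<n. sq_mat n b $$ (i, q i)) = signof q * (\<Prod>i = 0..<n. b i (q i))"
      by (simp only:)
  qed
  finally show ?thesis .
qed

text \<open>Cramer's rule in multiplied-out form, valid for singular matrices as well.\<close>

lemma det_replace_column:
  assumes "k < n"
  shows "Determinant.det (sq_mat n (\<lambda>i j. if j = k then \<Sum>l<n. b i l * x l else b i j)) = x k * Determinant.det (sq_mat n b)"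
proof -
  let ?A = "sq_mat n b" and ?x = "vec n x"
  have "replace_col ?A (?A *\<^sub>v ?x) k = sq_mat n (\<lambda>i j. if j = k then \<Sum>l<n. b i l * x l else b i j)"
    by (rule eq_matI) (auto simp: replace_col_def scalar_prod_def atLeast0LessThan)
  then show ?thesis
    using cramer_lemma_mat[of ?A n ?x k] assms by simp
qed

definition id_minus :: "(nat \<Rightarrow> nat \<Rightarrow> complex) \<Rightarrow> nat \<Rightarrow> nat \<Rightarrow> complex" where
  "id_minus a = (\<lambda>i j. (if i = j then 1 else 0) - a i j)"

text \<open>Abstracts the matrix A(w) at a fixed \<open>w\<close>: \<open>s\<close> comes from the
  nuclear representation, and \<open>r\<close> carries the whole dependence on
  \<open>w\<close>.\<close>

locale factored_matrix =
  fixes a :: "nat \<Rightarrow> nat \<Rightarrow> complex" and s :: "nat \<Rightarrow> real" and r :: real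
  assumes a_le: "cmod (a i j) \<le> r * s i * s j"
    and s_nonneg: "0 \<le> s i" and r_nonneg: "0 \<le> r" and s_summable: "summable (\<lambda>i. (s i)\<^sup>2)"
begin

definition S :: real where "S = (\<Sum>i. (s i)\<^sup>2)"

lemma partial_le_S: "(\<Sum>i<n. (s i)\<^sup>2) \<le> S"
  unfolding S_def by (rule sum_le_suminf[OF s_summable]) auto

lemma S_nonneg: "0 \<le> S"
  using partial_le_S[of 0] by simp

text \<open>The diagonal entry contributes 1 plus a multiple of \<open>(s j)\<^sup>2\<close> and the
  rest is of the same order, so 1 + x \<le> exp x gives a bound whose product over the columns does
  not depend on the size of the section.\<close>

lemma column_le:
  assumes "j < n"
  shows "(\<Sum>i<n. (cmod (id_minus a i j))\<^sup>2) \<le> exp ((s j)\<^sup>2 * (2 * r + S * r\<^sup>2))"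
proof -
  have "(cmod (id_minus a i j))\<^sup>2 \<le> (if i = j then 1 + 2 * r * (s j)\<^sup>2 else 0) + r\<^sup>2 * (s j)\<^sup>2 * (s i)\<^sup>2" for i
  proof -
    have sq: "(cmod (a i j))\<^sup>2 \<le> r\<^sup>2 * (s j)\<^sup>2 * (s i)\<^sup>2"
      using power_mono[OF a_le[of i j], of 2] by (simp add: power_mult_distrib mult_ac)
    show ?thesis
    proof (cases "i = j")
      case True
      have "cmod (id_minus a i j) \<le> 1 + cmod (a i j)"
        using norm_triangle_ineq4[of 1 "a i j"] True by (simp add: id_minus_def)
      then have "(cmod (id_minus a i j))\<^sup>2 \<le> (1 + cmod (a i j))\<^sup>2"
        by (intro power_mono) auto
      also have "\<dots> = 1 + 2 * cmod (a i j) + (cmod (a i j))\<^sup>2"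
        by (simp add: power2_eq_square algebra_simps)
      finally show ?thesis
        using sq a_le[of i j] True by (simp add: power2_eq_square mult.assoc)
    qed (use sq in \<open>simp add: id_minus_def\<close>)
  qed
  then have "(\<Sum>i<n. (cmod (id_minus a i j))\<^sup>2) \<le>
      (\<Sum>i<n. (if i = j then 1 + 2 * r * (s j)\<^sup>2 else 0) + r\<^sup>2 * (s j)\<^sup>2 * (s i)\<^sup>2)"
    by (rule sum_mono)
  also have "\<dots> = 1 + 2 * r * (s j)\<^sup>2 + r\<^sup>2 * (s j)\<^sup>2 * (\<Sum>i<n. (s i)\<^sup>2)"
    using assms by (simp add: sum.distrib sum_distrib_left)
  also have "\<dots> \<le> 1 + 2 * r * (s j)\<^sup>2 + r\<^sup>2 * (s j)\<^sup>2 * S"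
    using partial_le_S by (intro add_left_mono mult_left_mono) auto
  also have "\<dots> = 1 + (s j)\<^sup>2 * (2 * r + S * r\<^sup>2)"
    by (simp add: algebra_simps)
  also have "\<dots> \<le> exp ((s j)\<^sup>2 * (2 * r + S * r\<^sup>2))"
    by (rule exp_ge_add_one_self)
  finally show ?thesis .
qed

text \<open>Formulated for a set of columns so that it also applies after one column has been
  singled out for replacement.\<close>

lemma prod_columns_le:
  assumes "J \<subseteq> {..<n}"
  shows "(\<Prod>j\<in>J. \<Sum>i<n. (cmod (id_minus a i j))\<^sup>2) \<le> exp (S * (2 * r + S * r\<^sup>2))"
proof -
  have fin: "finite J" using assms finite_subset by blast
  have "(\<Prod>j\<in>J. \<Sum>i<n. (cmod (id_minus a i j))\<^sup>2) \<le> (\<Prod>j\<in>J. exp ((s j)\<^sup>2 * (2 * r + S * r\<^sup>2)))"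
    using assms column_le by (intro prod_mono) (auto intro!: sum_nonneg)
  also have "\<dots> = exp ((\<Sum>j\<in>J. (s j)\<^sup>2) * (2 * r + S * r\<^sup>2))"
    using fin by (simp add: exp_sum sum_distrib_right)
  also have "(\<Sum>j\<in>J. (s j)\<^sup>2) \<le> S"
    unfolding S_def by (rule sum_le_suminf[OF s_summable fin]) auto
  then have "exp ((\<Sum>j\<in>J. (s j)\<^sup>2) * (2 * r + S * r\<^sup>2)) \<le> exp (S * (2 * r + S * r\<^sup>2))"
    using r_nonneg S_nonneg unfolding exp_le_cancel_iff by (intro mult_right_mono) auto
  finally show ?thesis .
qed

lemma det_le:
  "cmod (Determinant.det (sq_mat n (id_minus a))) \<le> exp (S * r + S\<^sup>2 * r\<^sup>2 / 2)"
proof -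
  have "cmod (Determinant.det (sq_mat n (id_minus a))) \<le> sqrt (\<Prod>j<n. \<Sum>i<n. (cmod (id_minus a i j))\<^sup>2)"
    by (rule hadamard_inequality_columns)
  also have "\<dots> \<le> sqrt (exp (S * (2 * r + S * r\<^sup>2)))"
    using prod_columns_le[of "{..<n}"] by simp
  also have "S * (2 * r + S * r\<^sup>2) = 2 * (S * r + S\<^sup>2 * r\<^sup>2 / 2)"
    by (simp add: power2_eq_square algebra_simps)
  also have "sqrt (exp (2 * (S * r + S\<^sup>2 * r\<^sup>2 / 2))) = exp (S * r + S\<^sup>2 * r\<^sup>2 / 2)"
    unfolding exp_double by (rule real_sqrt_unique) simp_all
  finally show ?thesis .
qed

lemma det_replaced_le:
  assumes "k < n"
  shows "(cmod (Determinant.det (sq_mat n (\<lambda>i j. if j = k then t i else id_minus a i j))))\<^sup>2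
     \<le> (\<Sum>i<n. (cmod (t i))\<^sup>2) * exp (S * (2 * r + S * r\<^sup>2))"
proof -
  let ?b = "\<lambda>i j. if j = k then t i else id_minus a i j"
  have "(cmod (Determinant.det (sq_mat n ?b)))\<^sup>2 \<le> (\<Prod>j<n. \<Sum>i<n. (cmod (?b i j))\<^sup>2)"
    using power_mono[OF hadamard_inequality_columns[of n ?b], of 2]
    by (simp add: prod_nonneg sum_nonneg)
  also have "\<dots> = (\<Sum>i<n. (cmod (?b i k))\<^sup>2) * (\<Prod>j\<in>{..<n} - {k}. \<Sum>i<n. (cmod (?b i j))\<^sup>2)"
    using assms by (intro prod.remove) auto
  also have "(\<Prod>j\<in>{..<n} - {k}. \<Sum>i<n. (cmod (?b i j))\<^sup>2) = (\<Prod>j\<in>{..<n} - {k}. \<Sum>i<n. (cmod (id_minus a i j))\<^sup>2)"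
    by (rule prod.cong) auto
  also have "(\<Sum>i<n. (cmod (?b i k))\<^sup>2) * (\<Prod>j\<in>{..<n} - {k}. \<Sum>i<n. (cmod (id_minus a i j))\<^sup>2)
      \<le> (\<Sum>i<n. (cmod (t i))\<^sup>2) * exp (S * (2 * r + S * r\<^sup>2))"
    using prod_columns_le[of "{..<n} - {k}" n] by (intro mult_mono) (auto intro!: sum_nonneg prod_nonneg)
  finally show ?thesis .
qed

text \<open>By Cramer's rule, \<open>x\<^sub>k det (1 - a)\<^sub>N\<close> is the determinant with column \<open>k\<close> replaced by the tails
  of the series for \<open>x\<close>.\<close>

lemma det_tendsto_0:
  assumes x: "\<And>i. (\<lambda>j. a i j * x j) sums x i" and x_le: "\<And>j. cmod (x j) \<le> G * s j"
    and k: "x k \<noteq> 0"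
  shows "(\<lambda>n. Determinant.det (sq_mat n (id_minus a))) \<longlonglongrightarrow> 0"
proof -
  define \<epsilon> where "\<epsilon> n = S - (\<Sum>i<n. (s i)\<^sup>2)" for n
  have \<epsilon>0: "\<epsilon> \<longlonglongrightarrow> 0"
  proof -
    have "(\<lambda>n. S - (\<Sum>i<n. (s i)\<^sup>2)) \<longlonglongrightarrow> S - S"
      unfolding S_def by (intro tendsto_intros summable_LIMSEQ s_summable)
    then show ?thesis by (simp add: \<epsilon>_def[abs_def])
  qed
  have \<epsilon>_nonneg: "0 \<le> \<epsilon> n" for n using partial_le_S by (simp add: \<epsilon>_def)
  have G: "0 \<le> G"
  proof (rule ccontr)
    assume "\<not> 0 \<le> G"
    then have "G * s k \<le> 0" using s_nonneg by (intro mult_nonpos_nonneg) auto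
    moreover have "0 < cmod (x k)" using k by simp
    ultimately show False using x_le[of k] by linarith
  qed
  define t where "t n i = x i - (\<Sum>j<n. a i j * x j)" for n i
  \<comment> \<open>Both \<open>a i j\<close> and \<open>x j\<close> carry a factor
    \<open>s j\<close>, so the tail of the series is dominated by the tail \<epsilon> of the sum of
    squares.\<close>
  have t_le: "cmod (t n i) \<le> r * G * s i * \<epsilon> n" for n i
  proof -
    have le: "cmod (a i (j + n) * x (j + n)) \<le> r * G * s i * (s (j + n))\<^sup>2" for j
    proof -
      have "cmod (a i (j + n)) * cmod (x (j + n)) \<le> (r * s i * s (j + n)) * (G * s (j + n))"
        using s_nonneg r_nonneg by (intro mult_mono a_le x_le) auto
      then show ?thesis by (simp add: norm_mult power2_eq_square mult_ac)
    qed
    have A: "(\<lambda>j. a i (j + n) * x (j + n)) sums t n i"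
      unfolding t_def using x[of i] by (rule sums_split_initial_segment)
    have B: "(\<lambda>j. r * G * s i * (s (j + n))\<^sup>2) sums (r * G * s i * \<epsilon> n)"
      unfolding \<epsilon>_def S_def
      by (intro sums_mult sums_split_initial_segment[OF summable_sums[OF s_summable]])
    show ?thesis
      unfolding sums_unique[OF A] sums_unique[OF B] by (rule norm_suminf_le[OF le sums_summable[OF B]])
  qed
  have t_eq: "(\<Sum>j<n. id_minus a i j * x j) = t n i" if "i < n" for i n
  proof -
    have "(\<Sum>j<n. id_minus a i j * x j) = (\<Sum>j<n. (if i = j then x j else 0) - a i j * x j)"
      by (rule sum.cong) (auto simp: id_minus_def left_diff_distrib)
    also have "\<dots> = t n i"
      unfolding sum_subtractf t_def using that by simp
    finally show ?thesis .
  qed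
  define E where "E = (r * G)\<^sup>2 * S * exp (S * (2 * r + S * r\<^sup>2))"
  \<comment> \<open>By Cramer's rule the left side is the squared modulus of a determinant whose
    column \<open>k\<close> consists of the tails; Hadamard's bound makes it of order
    \<open>(\<epsilon> n)\<^sup>2\<close>, uniformly otherwise.\<close>
  have main: "(cmod (x k) * cmod (Determinant.det (sq_mat n (id_minus a))))\<^sup>2 \<le> E * (\<epsilon> n)\<^sup>2" if "k < n" for n
  proof -
    have "sq_mat n (\<lambda>i j. if j = k then \<Sum>l<n. id_minus a i l * x l else id_minus a i j) =
        sq_mat n (\<lambda>i j. if j = k then t n i else id_minus a i j)"
      by (rule eq_matI) (auto simp: t_eq)
    then have "x k * Determinant.det (sq_mat n (id_minus a)) =
        Determinant.det (sq_mat n (\<lambda>i j. if j = k then t n i else id_minus a i j))"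
      using det_replace_column[OF that, of "id_minus a" x] by simp
    then have "(cmod (x k) * cmod (Determinant.det (sq_mat n (id_minus a))))\<^sup>2
        \<le> (\<Sum>i<n. (cmod (t n i))\<^sup>2) * exp (S * (2 * r + S * r\<^sup>2))"
      using det_replaced_le[OF that, of "t n"] by (metis norm_mult)
    also have "(\<Sum>i<n. (cmod (t n i))\<^sup>2) \<le> (\<Sum>i<n. (r * G)\<^sup>2 * (\<epsilon> n)\<^sup>2 * (s i)\<^sup>2)"
    proof (rule sum_mono)
      fix i
      show "(cmod (t n i))\<^sup>2 \<le> (r * G)\<^sup>2 * (\<epsilon> n)\<^sup>2 * (s i)\<^sup>2"
        using power_mono[OF t_le[of n i], of 2] by (simp add: power_mult_distrib mult_ac)
    qed
    also have "(\<Sum>i<n. (r * G)\<^sup>2 * (\<epsilon> n)\<^sup>2 * (s i)\<^sup>2) = (r * G)\<^sup>2 * (\<epsilon> n)\<^sup>2 * (\<Sum>i<n. (s i)\<^sup>2)"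
      by (rule sum_distrib_left[symmetric])
    also have "\<dots> \<le> (r * G)\<^sup>2 * (\<epsilon> n)\<^sup>2 * S"
      using partial_le_S by (intro mult_left_mono) auto
    finally show ?thesis by (simp add: E_def mult_ac)
  qed
  have "(\<lambda>n. E / (cmod (x k))\<^sup>2 * (\<epsilon> n)\<^sup>2) \<longlonglongrightarrow> E / (cmod (x k))\<^sup>2 * 0\<^sup>2"
    by (intro tendsto_intros \<epsilon>0)
  then have "(\<lambda>n. E / (cmod (x k))\<^sup>2 * (\<epsilon> n)\<^sup>2) \<longlonglongrightarrow> 0" by simp
  moreover have "\<forall>\<^sub>F n in sequentially. norm ((cmod (Determinant.det (sq_mat n (id_minus a))))\<^sup>2) \<le> E / (cmod (x k))\<^sup>2 * (\<epsilon> n)\<^sup>2"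
    using eventually_gt_at_top[of k]
  proof eventually_elim
    case (elim n)
    have "0 < (cmod (x k))\<^sup>2" using k by simp
    then show ?case using main[OF elim] by (simp add: power_mult_distrib pos_le_divide_eq mult.commute)
  qed
  ultimately have "(\<lambda>n. (cmod (Determinant.det (sq_mat n (id_minus a))))\<^sup>2) \<longlonglongrightarrow> 0"
    by (rule Lim_null_comparison[rotated])
  then have "(\<lambda>n. sqrt ((cmod (Determinant.det (sq_mat n (id_minus a))))\<^sup>2)) \<longlonglongrightarrow> sqrt 0"
    by (rule tendsto_real_sqrt)
  then show ?thesis by (simp add: tendsto_norm_zero_iff)
qed

end

section \<open>The perturbation determinant\<close>

text \<open>\<open>D\<close> is a subsequential limit of the finite-section determinants. At an
  eigenvalue the full sequence tends to 0, so the limit vanishes there along whichever subsequence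
  was chosen.\<close>

theorem perturbation_determinant:
  assumes p: "1 \<le> p" and nuc: "nuclear_op p K"
  obtains D C where "D holomorphic_on ball 0 1" "D 0 = 1" "C \<ge> (0::real)"
    "\<And>w. cmod w < 1 \<Longrightarrow> cmod (D w) \<le> exp (C / ((1 - cmod w)\<^sup>2 * (cmod (1 - w\<^sup>2))\<^sup>2))"
    "\<And>w g. cmod w < 1 \<Longrightarrow> w \<noteq> 0 \<Longrightarrow> g \<in> lp p \<Longrightarrow> g \<noteq> 0 \<Longrightarrow>
        (\<And>n. laplacian g n + K g n = (w + 1 / w) * g n) \<Longrightarrow> D w = 0"
proof -
  obtain f s \<phi> where f: "\<And>n::nat. f n \<in> lp p" "\<And>n. lp_norm p (f n) \<le> s n"
    and \<phi>: "\<And>n. bounded_functional p (s n) (\<phi> n)" and s: "\<And>n. 0 \<le> s n" "summable (\<lambda>n. (s n)\<^sup>2)"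
    and K: "\<And>g. g \<in> lp p \<Longrightarrow> (\<lambda>N. lp_norm p (K g - (\<Sum>n<N. \<phi> n g *\<^sub>C f n))) \<longlonglongrightarrow> 0"
    by (fact nuclear_op_rescaled[OF p nuc])
  have "bounded_op p K" by (rule nuc[unfolded nuclear_op_def compact_op_def, THEN conjunct1, THEN conjunct1])
  then have K_lp: "K g \<in> lp p" if "g \<in> lp p" for g
    using that by (simp only: bounded_op_def)
  define a where "a w i j = w / (1 - w\<^sup>2) * kernel_sum (\<phi> i) w (f j)" for w i j
  define y where "y w = 1 / ((1 - cmod w) * cmod (1 - w\<^sup>2))" for w :: complex
  define F where "F n w = Determinant.det (sq_mat n (id_minus (a w)))" for n w
  define S where "S = (\<Sum>i. (s i)\<^sup>2)"
  \<comment> \<open>From the exponent S r + S^2 r^2 / 2 with r = 2 y: the quadratic term gives 2 S^2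
    y^2, and y \<ge> 1/2 turns the linear term 2 S y into at most 4 S y^2.\<close>
  define C where "C = 4 * S + 2 * S\<^sup>2"
  have S: "0 \<le> S" unfolding S_def by (rule suminf_nonneg[OF s(2)]) simp
  then have C: "0 \<le> C" by (simp add: C_def)
  have w2: "w\<^sup>2 \<noteq> 1" if "cmod w < 1" for w :: complex
    using that by (metis norm_one norm_power power_less_one_iff abs_norm_cancel abs_square_less_1 less_irrefl)
  have w2_ball: "1 - w\<^sup>2 \<noteq> 0" if "w \<in> ball 0 1" for w :: complex
  proof
    assume "1 - w\<^sup>2 = 0"
    then have "1 = w\<^sup>2" by (simp only: right_minus_eq)
    moreover have "cmod w < 1" using that by simp
    ultimately show False using w2 by metis
  qed
  have y_half: "1 / 2 \<le> y w" if w: "cmod w < 1" for w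
  proof -
    have "cmod (1 - w\<^sup>2) \<le> 1 + (cmod w)\<^sup>2"
      using norm_triangle_ineq4[of 1 "w\<^sup>2"] by (simp add: norm_power)
    also have "\<dots> \<le> 2" using w by (simp add: power_le_one)
    finally have "(1 - cmod w) * cmod (1 - w\<^sup>2) \<le> 1 * 2"
      using w by (intro mult_mono) auto
    moreover have "0 < (1 - cmod w) * cmod (1 - w\<^sup>2)" using w w2[OF w] by simp
    ultimately show ?thesis unfolding y_def by (intro frac_le) auto
  qed
  have fm: "factored_matrix (a w) s (2 * y w)" if w: "cmod w < 1" for w
  proof
    show "cmod (a w i j) \<le> 2 * y w * s i * s j" for i j
    proof -
      have pos: "0 < 1 - cmod w" using w by simp
      have "cmod (kernel_sum (\<phi> i) w (f j)) \<le> 2 / (1 - cmod w) * s i * lp_norm p (f j)"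
        by (rule kernel_sum_summable(2)[OF p \<phi> f(1) w])
      also have "\<dots> \<le> 2 / (1 - cmod w) * s i * s j"
        using pos s(1) f(2) by (intro mult_left_mono mult_nonneg_nonneg divide_nonneg_nonneg) auto
      finally have 1: "cmod (kernel_sum (\<phi> i) w (f j)) \<le> 2 / (1 - cmod w) * s i * s j" .
      have 2: "cmod (w / (1 - w\<^sup>2)) \<le> 1 / cmod (1 - w\<^sup>2)"
        unfolding norm_divide using w by (intro divide_right_mono) auto
      have "cmod (a w i j) \<le> 1 / cmod (1 - w\<^sup>2) * (2 / (1 - cmod w) * s i * s j)"
        unfolding a_def norm_mult by (rule mult_mono[OF 2 1]) auto
      also have "\<dots> = 2 * y w * s i * s j" by (simp add: y_def)
      finally show ?thesis .
    qed
    show "0 \<le> 2 * y w" using y_half[OF w] by simp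
  qed (use s in auto)
  have F_le: "cmod (F n w) \<le> exp (C / ((1 - cmod w)\<^sup>2 * (cmod (1 - w\<^sup>2))\<^sup>2))" if w: "cmod w < 1" for n w
  proof -
    interpret I: factored_matrix "a w" s "2 * y w" by (rule fm[OF w])
    have SS: "I.S = S" by (simp only: I.S_def S_def)
    have "cmod (F n w) \<le> exp (S * (2 * y w) + S\<^sup>2 * (2 * y w)\<^sup>2 / 2)"
      unfolding F_def SS[symmetric] by (rule I.det_le)
    also have "S * (2 * y w) + S\<^sup>2 * (2 * y w)\<^sup>2 / 2 \<le> C * (y w)\<^sup>2"
    proof -
      have "y w * 1 \<le> y w * (2 * y w)"
        using y_half[OF w] by (intro mult_left_mono) auto
      then have "S * (2 * y w) \<le> S * (4 * (y w)\<^sup>2)"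
        using S by (intro mult_left_mono) (auto simp: power2_eq_square)
      then show ?thesis by (simp add: C_def algebra_simps)
    qed
    also have "C * (y w)\<^sup>2 = C / ((1 - cmod w)\<^sup>2 * (cmod (1 - w\<^sup>2))\<^sup>2)"
      by (simp add: y_def power_divide power_mult_distrib)
    finally show ?thesis by simp
  qed
  have hol_a: "(\<lambda>w. a w i j) holomorphic_on ball 0 1" for i j
    unfolding a_def
    by (intro holomorphic_intros kernel_sum_holomorphic[OF p \<phi> f(1)]) (use w2_ball in blast)
  have hol_F: "F n holomorphic_on ball 0 1" for n
    \<comment> \<open>The Leibniz formula exhibits the determinant as a finite sum of products of
      entries.\<close>
    unfolding F_def det_sq_mat id_minus_def by (intro holomorphic_intros hol_a)
  obtain D r where D: "D holomorphic_on ball 0 1" and r: "strict_mono (r :: nat \<Rightarrow> nat)"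
    and lim: "\<And>w. w \<in> ball 0 1 \<Longrightarrow> (\<lambda>n. F (r n) w) \<longlonglongrightarrow> D w"
  proof (rule Montel[of "ball (0::complex) 1" "range F" F])
    show "\<exists>B. \<forall>h\<in>range F. \<forall>z\<in>K'. norm (h z) \<le> B" if K': "compact K'" "K' \<subseteq> ball 0 1" for K'
    proof -
      have "continuous_on K' (\<lambda>w. exp (C / ((1 - cmod w)\<^sup>2 * (cmod (1 - w\<^sup>2))\<^sup>2)))"
        using K'(2) w2_ball by (intro continuous_intros) fastforce+
      then have "bounded ((\<lambda>w. exp (C / ((1 - cmod w)\<^sup>2 * (cmod (1 - w\<^sup>2))\<^sup>2))) ` K')"
        using K'(1) compact_continuous_image compact_imp_bounded by blast
      then obtain B where B: "\<And>w. w \<in> K' \<Longrightarrow> norm (exp (C / ((1 - cmod w)\<^sup>2 * (cmod (1 - w\<^sup>2))\<^sup>2))) \<le> B"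
        by (auto simp: bounded_iff)
      have "norm (F n w) \<le> B" if "w \<in> K'" for n w
        using F_le[of w n] B[OF that] K'(2) that by force
      then show ?thesis by blast
    qed
  qed (use hol_F in auto)
  show ?thesis
  proof (rule that[OF D _ C])
    \<comment> \<open>The prefactor \<open>w / (1 - w\<^sup>2)\<close> vanishes at 0, so every
      section there is an identity matrix.\<close>
    have "a 0 = (\<lambda>i j. 0)" by (simp add: a_def[abs_def])
    then have "sq_mat n (id_minus (a 0)) = 1\<^sub>m n" for n
      by (intro eq_matI) (auto simp: id_minus_def)
    then have "F n 0 = 1" for n by (simp add: F_def)
    then show "D 0 = 1" using lim[of 0] LIMSEQ_unique[OF _ tendsto_const] by simp
    show "cmod (D w) \<le> exp (C / ((1 - cmod w)\<^sup>2 * (cmod (1 - w\<^sup>2))\<^sup>2))" if w: "cmod w < 1" for w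
    proof (rule LIMSEQ_le_const2)
      show "(\<lambda>n. cmod (F (r n) w)) \<longlonglongrightarrow> cmod (D w)"
        using lim[of w] w by (intro tendsto_norm) auto
    qed (use F_le[OF w] in auto)
    show "D w = 0" if w: "cmod w < 1" "w \<noteq> 0" and g: "g \<in> lp p" "g \<noteq> 0"
      and eigen: "\<And>n. laplacian g n + K g n = (w + 1 / w) * g n" for w g
    proof -
      let ?h = "K g"
      have h: "?h \<in> lp p" by (rule K_lp[OF g(1)])
      have eq: "?h n = (w + 1 / w) * g n - g (n - 1) - g (n + 1)" for n
        using eigen[of n] by (simp add: laplacian_def algebra_simps)
      have w2': "1 - w\<^sup>2 \<noteq> 0" using w2[OF w(1)] by simp
      have unit: "w / (1 - w\<^sup>2) * (1 / w - w) = 1"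
        using w(2) w2' by (simp add: power2_eq_square field_simps)
      \<comment> \<open>The eigenvalue equation says that \<open>K g\<close> is (\<lambda> -
        \<Delta>) g, so the resolvent kernel recovers \<open>g\<close> under every bounded
        functional.\<close>
      have ks: "w / (1 - w\<^sup>2) * kernel_sum \<psi> w ?h = \<psi> g" if "bounded_functional p t \<psi>" for \<psi> t
        unfolding kernel_sum_eq[OF p that g(1) h w eq] mult.assoc[symmetric] unit by simp
      \<comment> \<open>The vector of all \<open>\<phi> j g\<close> is fixed by A(w): expand
        \<open>K g\<close> in its nuclear series and apply the previous identity.\<close>
      have sums: "(\<lambda>j. a w i j * \<phi> j g) sums \<phi> i g" for i
      proof -
        let ?t = "2 / (1 - cmod w) * s i"
        have T: "bounded_functional p ?t (kernel_sum (\<phi> i) w)"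
          by (rule bounded_functional_kernel_sum[OF p \<phi> w(1)])
        have diff: "kernel_sum (\<phi> i) w ?h - (\<Sum>j<N. \<phi> j g * kernel_sum (\<phi> i) w (f j)) =
            kernel_sum (\<phi> i) w (?h - (\<Sum>j<N. \<phi> j g *\<^sub>C f j))" for N
        proof -
          have fl: "\<And>j. \<phi> j g *\<^sub>C f j \<in> lp p" by (rule lp_scale[OF f(1)])
          show ?thesis
            unfolding bounded_functional_diff[OF T h lp_sum[OF p fl]] bounded_functional_sum[OF p T fl]
              bounded_functional_scale[OF T f(1)] ..
        qed
        have "(\<lambda>N. kernel_sum (\<phi> i) w ?h - (\<Sum>j<N. \<phi> j g * kernel_sum (\<phi> i) w (f j))) \<longlonglongrightarrow> 0"
        proof (rule Lim_null_comparison)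
          show "\<forall>\<^sub>F N in sequentially. norm (kernel_sum (\<phi> i) w ?h - (\<Sum>j<N. \<phi> j g * kernel_sum (\<phi> i) w (f j)))
              \<le> ?t * lp_norm p (?h - (\<Sum>j<N. \<phi> j g *\<^sub>C f j))"
            unfolding diff
            by (intro always_eventually allI bounded_functional_le[OF T] lp_diff[OF p h] lp_sum[OF p] lp_scale[OF f(1)])
          show "(\<lambda>N. ?t * lp_norm p (?h - (\<Sum>j<N. \<phi> j g *\<^sub>C f j))) \<longlonglongrightarrow> 0"
            by (rule tendsto_mult_right_zero[OF K[OF g(1)]])
        qed
        then have "(\<lambda>N. kernel_sum (\<phi> i) w ?h - (kernel_sum (\<phi> i) w ?h - (\<Sum>j<N. \<phi> j g * kernel_sum (\<phi> i) w (f j))))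
            \<longlonglongrightarrow> kernel_sum (\<phi> i) w ?h - 0"
          by (intro tendsto_diff tendsto_const)
        then have "(\<lambda>j. \<phi> j g * kernel_sum (\<phi> i) w (f j)) sums kernel_sum (\<phi> i) w ?h"
          by (simp add: sums_def)
        then have "(\<lambda>j. w / (1 - w\<^sup>2) * (\<phi> j g * kernel_sum (\<phi> i) w (f j))) sums (w / (1 - w\<^sup>2) * kernel_sum (\<phi> i) w ?h)"
          by (rule sums_mult)
        then show ?thesis
          unfolding ks[OF \<phi>] a_def by (simp only: mult_ac)
      qed
      \<comment> \<open>Otherwise \<open>K g = 0\<close>, and testing the resolvent identity against
        coordinate functionals forces \<open>g = 0\<close>.\<close>
      have "\<exists>k. \<phi> k g \<noteq> 0"
      proof (rule ccontr)
        assume "\<not> (\<exists>k. \<phi> k g \<noteq> 0)"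
        then have z: "\<phi> k g = 0" for k by blast
        have "(\<Sum>j<N. \<phi> j g *\<^sub>C f j) = 0" for N
          unfolding z scale_zero_left by simp
        then have "(\<lambda>N::nat. lp_norm p (?h - 0)) \<longlonglongrightarrow> 0"
          using K[OF g(1)] by (simp only:)
        then have "lp_norm p (?h - 0) = 0" by (rule LIMSEQ_unique[OF tendsto_const])
        then have "?h n = 0" for n
          using coordinate_le_lp_norm[OF p h, of n] by (simp only: diff_0_right norm_le_zero_iff)
        then have h0: "?h = 0" by auto
        have "g n = 0" for n
          using ks[OF bounded_functional_coordinate[OF p, of n]]
            bounded_functional_zero[OF bounded_functional_kernel_sum[OF p bounded_functional_coordinate[OF p, of n] w(1)]]
          unfolding h0 by simp
        then show False using g(2) by auto
      qed
      then obtain k where k: "\<phi> k g \<noteq> 0" by blast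
      interpret I: factored_matrix "a w" s "2 * y w" by (rule fm[OF w(1)])
      have "(\<lambda>n. F n w) \<longlonglongrightarrow> 0"
        unfolding F_def
      proof (rule I.det_tendsto_0[OF sums _ k])
        show "cmod (\<phi> j g) \<le> lp_norm p g * s j" for j
          using bounded_functional_le[OF \<phi> g(1), of j] by (simp only: mult.commute)
      qed
      then have "(\<lambda>n. F (r n) w) \<longlonglongrightarrow> 0"
        using LIMSEQ_subseq_LIMSEQ[OF _ r] by (fastforce simp: o_def)
      then show "D w = 0"
        using lim[of w] w(1) LIMSEQ_unique by auto
    qed
  qed
qed

section \<open>Passage from the disc to the eigenvalues\<close>

text \<open>The two roots of w^2 - z w + 1 have product 1, so one lies inside the disc unless both
  lie on the circle; in that case they are conjugate and z = 2 Re w lies in the excluded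
  segment.\<close>

lemma joukowski_preimage:
  fixes z :: complex
  assumes "\<not> (Im z = 0 \<and> \<bar>Re z\<bar> \<le> 2)"
  obtains w where "w \<noteq> 0" "cmod w < 1" "w + 1 / w = z"
proof -
  define c where "c = csqrt (z\<^sup>2 - 4)"
  define w where "w = (z - c) / 2"
  have c2: "c * c = z\<^sup>2 - 4"
    using power2_csqrt[of "z\<^sup>2 - 4"] by (simp add: c_def power2_eq_square)
  have "w * (z - w) = (z * z - c * c) / 4"
    unfolding w_def by (simp add: field_simps)
  also have "\<dots> = 1" unfolding c2 by (simp add: power2_eq_square)
  finally have prod: "w * (z - w) = 1" .
  then have w0: "w \<noteq> 0" by auto
  then have inv: "1 / w = z - w" using prod by (simp add: divide_eq_eq mult.commute)
  show ?thesis
  proof (cases "cmod w" "1::real" rule: linorder_cases)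
    case less
    show ?thesis by (rule that[OF w0 less]) (simp add: inv)
  next
    case greater
    show ?thesis
    proof (rule that[of "1 / w"])
      show "cmod (1 / w) < 1" using greater by (simp add: norm_divide divide_less_eq)
      have "1 / w + w = z" by (simp add: inv)
      then show "1 / w + 1 / (1 / w) = z" by simp
    qed (use w0 in simp)
  next
    case equal
    then have "w * cnj w = 1" using complex_norm_square[of w] by simp
    then have "w * cnj w = w * (z - w)" using prod by simp
    then have "z - w = cnj w" using w0 by simp
    then have "z = w + cnj w" by (simp add: algebra_simps)
    then have "Im z = 0" "Re z = 2 * Re w" by simp_all
    then show ?thesis using assms abs_Re_le_cmod[of w] equal by simp
  qed
qed

text \<open>The imaginary part times |w|^2 equals -(1 - |w|^2) Im w. Moreover |Im w| is at most both
  |1 - w| and |1 + w|, one of which is at least 1, so it is at most |1 - w^2|.\<close>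

lemma Im_joukowski_le:
  assumes "w \<noteq> 0" "cmod w < 1"
  shows "\<bar>Im (w + 1 / w)\<bar> * (cmod w)\<^sup>2 \<le> (1 - (cmod w)\<^sup>2) * cmod (1 - w\<^sup>2)"
proof -
  have n: "(cmod w)\<^sup>2 \<noteq> 0" using assms by simp
  have "Im (1 / w) = - Im w / (cmod w)\<^sup>2"
    by (simp add: Im_divide')
  then have "Im (w + 1 / w) * (cmod w)\<^sup>2 = (Im w + - Im w / (cmod w)\<^sup>2) * (cmod w)\<^sup>2"
    by (simp only: plus_complex.sel)
  also have "\<dots> = - (Im w * (1 - (cmod w)\<^sup>2))"
    using n by (simp add: algebra_simps)
  finally have "\<bar>Im (w + 1 / w) * (cmod w)\<^sup>2\<bar> = \<bar>Im w * (1 - (cmod w)\<^sup>2)\<bar>"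
    by (simp only: abs_minus_cancel)
  then have "\<bar>Im (w + 1 / w)\<bar> * (cmod w)\<^sup>2 = \<bar>Im w\<bar> * \<bar>1 - (cmod w)\<^sup>2\<bar>"
    by (simp only: abs_mult abs_power2)
  also have "\<bar>1 - (cmod w)\<^sup>2\<bar> = 1 - (cmod w)\<^sup>2"
    using assms by (simp add: power_le_one)
  also have "\<bar>Im w\<bar> \<le> cmod (1 - w\<^sup>2)"
  proof -
    have "1 - w\<^sup>2 = (1 - w) * (1 + w)" by (simp add: power2_eq_square algebra_simps)
    then have e: "cmod (1 - w\<^sup>2) = cmod (1 - w) * cmod (1 + w)" by (simp only: norm_mult)
    have I: "\<bar>Im w\<bar> \<le> cmod (1 - w)" "\<bar>Im w\<bar> \<le> cmod (1 + w)"
      using abs_Im_le_cmod[of "1 - w"] abs_Im_le_cmod[of "1 + w"] by simp_all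
    show ?thesis
    proof (cases "0 \<le> Re w")
      case True
      then have "1 \<le> cmod (1 + w)" using complex_Re_le_cmod[of "1 + w"] by simp
      then have "\<bar>Im w\<bar> * 1 \<le> cmod (1 - w) * cmod (1 + w)" using I by (intro mult_mono) auto
      then show ?thesis unfolding e by simp
    next
      case False
      then have "1 \<le> cmod (1 - w)" using complex_Re_le_cmod[of "1 - w"] by simp
      then have "1 * \<bar>Im w\<bar> \<le> cmod (1 - w) * cmod (1 + w)" using I by (intro mult_mono) auto
      then show ?thesis unfolding e by simp
    qed
  qed
  then have "\<bar>Im w\<bar> * (1 - (cmod w)\<^sup>2) \<le> cmod (1 - w\<^sup>2) * (1 - (cmod w)\<^sup>2)"
    using assms by (intro mult_right_mono) (auto simp: power_le_one)
  finally show ?thesis by (simp only: mult.commute)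
qed

text \<open>Here (w + 1/w + 2) w = (1 + w)^2. The condition on the real part forces |1 + w| \<le> 1
  - |w|^2 and Re w \<le> 0; the latter gives |1 - w| \<ge> 1 and thus |1 + w| \<le> |1 - w^2|. Each
  bound is used for one factor.\<close>

lemma dist_joukowski_le:
  assumes "w \<noteq> 0" "cmod w < 1" "Re (w + 1 / w) \<le> - 2"
  shows "cmod (w + 1 / w + 2) * cmod w \<le> (1 - (cmod w)\<^sup>2) * cmod (1 - w\<^sup>2)"
proof -
  define n where "n = (cmod w)\<^sup>2"
  have n: "0 < n" "n \<le> 1" using assms by (auto simp: n_def power_le_one)
  have "Re (1 / w) = Re w / n"
    by (simp add: Re_divide' n_def)
  then have "Re w + Re w / n \<le> - 2"
    using assms(3) by (simp only: plus_complex.sel)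
  then have "(Re w + Re w / n) * n \<le> - 2 * n"
    using n by (intro mult_right_mono) auto
  then have "Re w * n + Re w \<le> - 2 * n"
    using n by (simp add: distrib_right)
  then have re: "Re w * (1 + n) \<le> - 2 * n" by (simp add: algebra_simps)
  have neg: "Re w \<le> 0"
  proof (rule ccontr)
    assume "\<not> Re w \<le> 0"
    then have "0 \<le> Re w * (1 + n)" using n by (intro mult_nonneg_nonneg) auto
    then show False using re n by linarith
  qed
  have sq: "(cmod (1 + w))\<^sup>2 = 1 + 2 * Re w + n"
    unfolding n_def cmod_power2 by (simp add: power2_eq_square algebra_simps)
  then have "(cmod (1 + w))\<^sup>2 * (1 + n) = (1 + n)\<^sup>2 + 2 * (Re w * (1 + n))"
    by (simp add: power2_eq_square algebra_simps)
  also have "\<dots> \<le> (1 + n)\<^sup>2 - 4 * n" using re by simp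
  also have "\<dots> = (1 - n)\<^sup>2" by (simp add: power2_eq_square algebra_simps)
  finally have "(cmod (1 + w))\<^sup>2 * (1 + n) \<le> (1 - n)\<^sup>2" .
  moreover have "(cmod (1 + w))\<^sup>2 * 1 \<le> (cmod (1 + w))\<^sup>2 * (1 + n)"
    using n by (intro mult_left_mono) auto
  ultimately have "(cmod (1 + w))\<^sup>2 \<le> (1 - n)\<^sup>2" by linarith
  then have A: "cmod (1 + w) \<le> 1 - n"
    by (rule power2_le_imp_le) (use n in simp)
  have "1 \<le> cmod (1 - w)" using neg complex_Re_le_cmod[of "1 - w"] by simp
  then have "1 * cmod (1 + w) \<le> cmod (1 - w) * cmod (1 + w)"
    by (rule mult_right_mono) simp
  also have "\<dots> = cmod (1 - w\<^sup>2)"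
    unfolding norm_mult[symmetric] by (simp add: power2_eq_square algebra_simps)
  finally have B: "cmod (1 + w) \<le> cmod (1 - w\<^sup>2)" by simp
  have "(w + 1 / w + 2) * w = (1 + w) * (1 + w)"
    using assms(1) by (simp add: field_simps)
  then have "cmod (w + 1 / w + 2) * cmod w = cmod (1 + w) * cmod (1 + w)"
    by (metis norm_mult)
  also have "\<dots> \<le> (1 - n) * cmod (1 - w\<^sup>2)"
    using n by (intro mult_mono A B) auto
  finally show ?thesis by (simp only: n_def)
qed

text \<open>The identity (z + c) (z - c) w^2 = (1 - w^2)^2 makes |1 - w^2|^2 at most (M + 2) |z +
  c|. Thus two of the 3 + \<tau> powers of |1 - w^2| pay for the division by |z + c|. The constant M
  + 1 bounds 1 / |w| = |z - w|.\<close>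

lemma joukowski_weight_le:
  fixes w z c :: complex
  assumes w: "w \<noteq> 0" "cmod w < 1" and z: "z = w + 1 / w" and M: "cmod z \<le> M"
    and Y: "0 \<le> Y" "Y * (cmod w)\<^sup>2 \<le> (1 - (cmod w)\<^sup>2) * cmod (1 - w\<^sup>2)"
    and \<tau>: "0 < \<tau>" and c: "c = 2 \<or> c = -2"
  shows "Y powr (3 + \<tau>) / cmod (z + c) \<le> ((M + 1)\<^sup>2) powr (3 + \<tau>) * (M + 2) *
     ((1 - (cmod w)\<^sup>2) powr (3 + \<tau>) * cmod (1 - w\<^sup>2) powr (1 + \<tau>))"
proof -
  define a where "a = 1 - (cmod w)\<^sup>2"
  define b where "b = cmod (1 - w\<^sup>2)"
  have a: "0 \<le> a" using w by (simp add: a_def power_le_one)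
  have "1 - w\<^sup>2 \<noteq> 0"
  proof
    assume "1 - w\<^sup>2 = 0"
    then have "1 = w\<^sup>2" by (simp only: right_minus_eq)
    then have "cmod (w\<^sup>2) = 1" by (metis norm_one)
    then have "(cmod w)\<^sup>2 = 1" by (simp only: norm_power)
    moreover have "(cmod w)\<^sup>2 < 1" using w by (simp add: abs_square_less_1)
    ultimately show False by linarith
  qed
  then have b: "0 < b" by (simp add: b_def)
  have w0: "0 < cmod w" using w by simp
  have M0: "0 \<le> M" using M norm_ge_zero order_trans by blast
  have "1 / cmod w = cmod (z - w)" by (simp add: z norm_divide)
  also have "\<dots> \<le> M + 1" using norm_triangle_ineq4[of z w] M w by linarith
  finally have "1 \<le> (M + 1) * cmod w" using w0 by (simp add: pos_divide_le_eq)
  then have "1\<^sup>2 \<le> ((M + 1) * cmod w)\<^sup>2" by (intro power_mono) auto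
  then have "Y * 1 \<le> Y * ((M + 1)\<^sup>2 * (cmod w)\<^sup>2)"
    using Y by (intro mult_left_mono) (auto simp: power_mult_distrib)
  also have "\<dots> = (M + 1)\<^sup>2 * (Y * (cmod w)\<^sup>2)" by (simp only: mult_ac)
  also have "\<dots> \<le> (M + 1)\<^sup>2 * (a * b)"
    unfolding a_def b_def using Y(2) by (rule mult_left_mono) simp
  finally have "Y powr (3 + \<tau>) \<le> ((M + 1)\<^sup>2 * (a * b)) powr (3 + \<tau>)"
    using Y \<tau> by (intro powr_mono2) auto
  also have "\<dots> = ((M + 1)\<^sup>2) powr (3 + \<tau>) * (a powr (3 + \<tau>) * b powr (3 + \<tau>))"
    using a b by (simp add: powr_mult)
  also have "b powr (3 + \<tau>) = b powr (1 + \<tau>) * b\<^sup>2"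
    using b by (simp add: powr_add[symmetric] flip: powr_numeral)
  finally have Yle: "Y powr (3 + \<tau>) \<le> ((M + 1)\<^sup>2) powr (3 + \<tau>) * (a powr (3 + \<tau>) * b powr (1 + \<tau>)) * b\<^sup>2"
    by (simp only: mult_ac)
  have "c * c = 4" using c by auto
  then have "(z + c) * (z - c) = z * z - 4" by (simp add: algebra_simps)
  also have "(z * z - 4) * w\<^sup>2 = (1 - w\<^sup>2)\<^sup>2"
    using w(1) by (simp add: z power2_eq_square field_simps)
  finally have "((z + c) * (z - c)) * w\<^sup>2 = (1 - w\<^sup>2)\<^sup>2" .
  then have "cmod ((z + c) * (z - c) * w\<^sup>2) = cmod ((1 - w\<^sup>2)\<^sup>2)"
    by (simp only:)
  then have "b\<^sup>2 = cmod (z + c) * (cmod (z - c) * (cmod w)\<^sup>2)"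
    by (simp only: b_def norm_mult norm_power mult.assoc)
  also have "\<dots> \<le> cmod (z + c) * ((M + 2) * 1)"
  proof (rule mult_left_mono[OF mult_mono])
    have "cmod c = 2" using c by auto
    then show "cmod (z - c) \<le> M + 2" using norm_triangle_ineq4[of z c] M by linarith
  qed (use w M0 in \<open>auto simp: power_le_one\<close>)
  finally have b2: "b\<^sup>2 \<le> cmod (z + c) * (M + 2)" by simp
  have "cmod (z + c) \<noteq> 0"
  proof
    assume "cmod (z + c) = 0"
    then have "b\<^sup>2 \<le> 0" using b2 by simp
    then show False using b by simp
  qed
  then have zc: "0 < cmod (z + c)" by simp
  let ?X = "((M + 1)\<^sup>2) powr (3 + \<tau>) * (a powr (3 + \<tau>) * b powr (1 + \<tau>))"
  have "?X * b\<^sup>2 \<le> ?X * (cmod (z + c) * (M + 2))"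
    using b2 by (rule mult_left_mono) simp
  with Yle have "Y powr (3 + \<tau>) \<le> ((M + 1)\<^sup>2) powr (3 + \<tau>) * (M + 2) * (a powr (3 + \<tau>) * b powr (1 + \<tau>)) * cmod (z + c)"
    by (simp only: mult_ac)
  then show ?thesis
    unfolding a_def[symmetric] b_def[symmetric] using zc by (simp only: pos_divide_le_eq)
qed

section \<open>Subsequences and summation over the eigenvalues\<close>

lemma subsequence_dichotomy:
  fixes P :: "nat \<Rightarrow> bool"
  shows "\<exists>r :: nat \<Rightarrow> nat. strict_mono r \<and> ((\<forall>k. P (r k)) \<or> (\<forall>k. \<not> P (r k)))"
proof -
  have "infinite {k. P k} \<or> infinite (UNIV - {k. P k})"
    using Diff_infinite_finite[OF _ infinite_UNIV_nat] by blast
  then obtain A where A: "infinite A" "A = {k. P k} \<or> A = UNIV - {k. P k}"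
    by blast
  have r: "strict_mono (enumerate A)" "enumerate A k \<in> A" for k
    using A(1) by (auto intro: strict_mono_enumerate enumerate_in_set)
  have "(\<forall>k. P (enumerate A k)) \<or> (\<forall>k. \<not> P (enumerate A k))"
    using A(2)
  proof
    assume *: "A = {k. P k}"
    have "P (enumerate A k)" for k using r(2)[of k] unfolding * by simp
    then show ?thesis by blast
  next
    assume *: "A = UNIV - {k. P k}"
    have "\<not> P (enumerate A k)" for k using r(2)[of k] unfolding * by simp
    then show ?thesis by blast
  qed
  with r(1) show ?thesis by blast
qed

text \<open>The common form of all cases: \<open>Y k\<close> will be the imaginary part in modulus
  or the distance to an endpoint. Eigenvalues off [-2, 2] correspond to zeros of the perturbation
  determinant; those on the segment have no preimage in the open disc and contribute 0 by
  \<open>Y_seg\<close>.\<close>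

lemma eigenvalues_summable:
  fixes p :: ennreal and \<mu> :: "nat \<Rightarrow> complex" and \<tau> :: real
  assumes p: "1 \<le> p" and nuc: "nuclear_op p K" and Z: "Z = laplacian + K"
    and inj: "inj \<mu>" and eig: "\<And>k. eigenvalue p Z (\<mu> k)"
    and bdd: "\<And>k. cmod (\<mu> k) \<le> M" and \<tau>: "0 < \<tau>" and c: "c = 2 \<or> c = -2"
    and Y0: "\<And>k. 0 \<le> Y k"
    and Y: "\<And>k w. \<mu> k = w + 1 / w \<Longrightarrow> w \<noteq> 0 \<Longrightarrow> cmod w < 1 \<Longrightarrow> Y k * (cmod w)\<^sup>2 \<le> (1 - (cmod w)\<^sup>2) * cmod (1 - w\<^sup>2)"
    and Y_seg: "\<And>k. Im (\<mu> k) = 0 \<Longrightarrow> \<bar>Re (\<mu> k)\<bar> \<le> 2 \<Longrightarrow> Y k = 0"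
  shows "summable (\<lambda>k. Y k powr (3 + \<tau>) / cmod (\<mu> k + c))"
proof -
  obtain D C where D: "D holomorphic_on ball 0 1" "D 0 = 1" "C \<ge> (0::real)"
    "\<And>w. cmod w < 1 \<Longrightarrow> cmod (D w) \<le> exp (C / ((1 - cmod w)\<^sup>2 * (cmod (1 - w\<^sup>2))\<^sup>2))"
    "\<And>w g. cmod w < 1 \<Longrightarrow> w \<noteq> 0 \<Longrightarrow> g \<in> lp p \<Longrightarrow> g \<noteq> 0 \<Longrightarrow>
        (\<And>n. laplacian g n + K g n = (w + 1 / w) * g n) \<Longrightarrow> D w = 0"
    by (fact perturbation_determinant[OF p nuc])
  define X where "X = {k. \<not> (Im (\<mu> k) = 0 \<and> \<bar>Re (\<mu> k)\<bar> \<le> 2)}"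
  have "\<exists>w. w \<noteq> 0 \<and> cmod w < 1 \<and> w + 1 / w = \<mu> k" if "k \<in> X" for k
  proof -
    have "\<not> (Im (\<mu> k) = 0 \<and> \<bar>Re (\<mu> k)\<bar> \<le> 2)" using that unfolding X_def by (rule CollectD)
    from joukowski_preimage[OF this] show ?thesis by metis
  qed
  then have "\<forall>k\<in>X. \<exists>w. w \<noteq> 0 \<and> cmod w < 1 \<and> w + 1 / w = \<mu> k" by blast
  from bchoice[OF this] obtain w where w: "\<forall>k\<in>X. w k \<noteq> 0 \<and> cmod (w k) < 1 \<and> w k + 1 / w k = \<mu> k"
    by blast
  define weight where "weight v = (1 - (cmod v)\<^sup>2) powr (3 + \<tau>) * (cmod (1 - v\<^sup>2)) powr (1 + \<tau>)" for v
  have "weight summable_on (w ` X)"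
    unfolding weight_def[abs_def]
  proof (rule zeros_summable[OF D(1,2,4,3) \<tau>])
    fix v assume "v \<in> w ` X"
    then obtain k where k: "k \<in> X" "v = w k" by blast
    obtain g where g: "g \<in> lp p" "g \<noteq> 0" "Z g = \<mu> k *\<^sub>C g"
      using eig[of k] unfolding eigenvalue_def by blast
    have vk: "v \<noteq> 0" "cmod v < 1" "v + 1 / v = \<mu> k"
      using w k by auto
    have "laplacian g n + K g n = (v + 1 / v) * g n" for n
      using fun_cong[OF g(3), of n] unfolding Z vk(3) by (simp add: scale_def)
    from D(5)[OF vk(2,1) g(1,2) this] vk(2) show "cmod v < 1 \<and> D v = 0" by simp
  qed
  \<comment> \<open>Since w + 1/w recovers the eigenvalue, distinct eigenvalues give distinct zeros,
    and the sum over zeros can be reindexed.\<close>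
  moreover have "inj_on w X"
  proof (rule inj_onI)
    fix j k assume jk: "j \<in> X" "k \<in> X" "w j = w k"
    then have "\<mu> j = \<mu> k" using w by metis
    then show "j = k" using inj by (rule injD[rotated])
  qed
  ultimately have "(weight \<circ> w) summable_on X"
    by (simp only: summable_on_reindex)
  then have "(\<lambda>k. ((M + 1)\<^sup>2) powr (3 + \<tau>) * (M + 2) * (weight \<circ> w) k) summable_on X"
    by (rule summable_on_cmult_right)
  then have "(\<lambda>k. Y k powr (3 + \<tau>) / cmod (\<mu> k + c)) summable_on X"
  proof (rule summable_on_comparison_test)
    fix k assume k: "k \<in> X"
    then have wk: "w k \<noteq> 0" "cmod (w k) < 1" "\<mu> k = w k + 1 / w k" using w by auto
    show "Y k powr (3 + \<tau>) / cmod (\<mu> k + c) \<le> ((M + 1)\<^sup>2) powr (3 + \<tau>) * (M + 2) * (weight \<circ> w) k"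
      unfolding o_apply weight_def
      by (rule joukowski_weight_le[OF wk bdd Y0 Y[OF wk(3,1,2)] \<tau> c])
    show "0 \<le> Y k powr (3 + \<tau>) / cmod (\<mu> k + c)" by simp
  qed
  moreover have "Y k powr (3 + \<tau>) / cmod (\<mu> k + c) = 0" if "k \<in> UNIV - X" for k
  proof -
    have "Y k = 0" using that Y_seg[of k] unfolding X_def by blast
    then show ?thesis by simp
  qed
  ultimately have "(\<lambda>k. Y k powr (3 + \<tau>) / cmod (\<mu> k + c)) summable_on UNIV"
    using summable_on_cong_neutral[of UNIV X "\<lambda>k. Y k powr (3 + \<tau>) / cmod (\<mu> k + c)" "\<lambda>k. Y k powr (3 + \<tau>) / cmod (\<mu> k + c)"]
    by blast
  then show ?thesis
    by (subst (asm) summable_on_UNIV_nonneg_real_iff) simp_all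
qed

theorem mainTheorem5:
  fixes p :: ennreal
    and K Z :: "bisequence \<Rightarrow> bisequence"
    and \<mu> :: "nat \<Rightarrow> complex"
    and l :: real
  assumes "1 \<le> p"
    and "nuclear_op p K"
    and "Z = laplacian + K"
    and "inj \<mu>"
    and "\<And>k. \<mu> k \<in> discrete_spectrum p Z"
    and "\<mu> \<longlonglongrightarrow> complex_of_real l"
    and "l \<in> {-2..2}"
  shows "(\<exists>r. strict_mono r \<and>
            (case_ia l (\<mu> \<circ> r) \<or> case_ib l (\<mu> \<circ> r) \<or> case_iia l (\<mu> \<circ> r) \<or>
             case_iib l (\<mu> \<circ> r) \<or> case_iii l (\<mu> \<circ> r))) \<and>
         (\<forall>\<tau>>0.
            (case_ia l \<mu> \<longrightarrow> summable (\<lambda>k. cmod (\<mu> k + 2) powr (2 + \<tau>))) \<and>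
            (case_ib l \<mu> \<longrightarrow> summable (\<lambda>k. cmod (\<mu> k - 2) powr (2 + \<tau>))) \<and>
            (case_iia l \<mu> \<longrightarrow> summable (\<lambda>k. \<bar>Im (\<mu> k)\<bar> powr (3 + \<tau>) / cmod (\<mu> k + 2))) \<and>
            (case_iib l \<mu> \<longrightarrow> summable (\<lambda>k. \<bar>Im (\<mu> k)\<bar> powr (3 + \<tau>) / cmod (\<mu> k - 2))) \<and>
            (case_iii l \<mu> \<longrightarrow> summable (\<lambda>k. \<bar>Im (\<mu> k)\<bar> powr (3 + \<tau>))))"
proof (intro conjI allI impI)
  show "\<exists>r. strict_mono r \<and>
            (case_ia l (\<mu> \<circ> r) \<or> case_ib l (\<mu> \<circ> r) \<or> case_iia l (\<mu> \<circ> r) \<or>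
             case_iib l (\<mu> \<circ> r) \<or> case_iii l (\<mu> \<circ> r))"
  proof -
    consider "l = -2" | "l = 2" | "-2 < l" "l < 2" using assms(7) by fastforce
    then show ?thesis
    proof cases
      case 1
      obtain r :: "nat \<Rightarrow> nat" where r: "strict_mono r" "(\<forall>k. Re (\<mu> (r k)) \<le> -2) \<or> (\<forall>k. \<not> Re (\<mu> (r k)) \<le> -2)"
        using subsequence_dichotomy[of "\<lambda>k. Re (\<mu> k) \<le> -2"] by blast
      then have "case_ia l (\<mu> \<circ> r) \<or> case_iia l (\<mu> \<circ> r)"
        by (simp only: 1 case_ia_def case_iia_def o_apply not_le simp_thms)
      then show ?thesis using r(1) by blast
    next
      case 2
      obtain r :: "nat \<Rightarrow> nat" where r: "strict_mono r" "(\<forall>k. 2 \<le> Re (\<mu> (r k))) \<or> (\<forall>k. \<not> 2 \<le> Re (\<mu> (r k)))"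
        using subsequence_dichotomy[of "\<lambda>k. 2 \<le> Re (\<mu> k)"] by blast
      then have "case_ib l (\<mu> \<circ> r) \<or> case_iib l (\<mu> \<circ> r)"
        by (simp only: 2 case_ib_def case_iib_def o_apply not_le simp_thms)
      then show ?thesis using r(1) by blast
    next
      case 3
      then have "case_iii l (\<mu> \<circ> id)" by (simp only: case_iii_def simp_thms)
      then show ?thesis using strict_mono_id by blast
    qed
  qed
  have eig: "eigenvalue p Z (\<mu> k)" for k
    using assms(5)[of k] unfolding discrete_spectrum_def by blast
  obtain M where M: "\<And>k. cmod (\<mu> k) \<le> M"
    using convergent_imp_Bseq[OF convergentI[OF assms(6)]] unfolding Bseq_def by blast
  note * = eigenvalues_summable[OF assms(1-4) eig M]
  fix \<tau> :: real assume \<tau>: "0 < \<tau>"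
  have Im_summable: "summable (\<lambda>k. \<bar>Im (\<mu> k)\<bar> powr (3 + \<tau>) / cmod (\<mu> k + c))" if "c = 2 \<or> c = -2" for c
  proof (rule *[OF \<tau> that])
    show "\<bar>Im (\<mu> k)\<bar> * (cmod w)\<^sup>2 \<le> (1 - (cmod w)\<^sup>2) * cmod (1 - w\<^sup>2)"
      if "\<mu> k = w + 1 / w" "w \<noteq> 0" "cmod w < 1" for k w
      unfolding that(1) by (rule Im_joukowski_le[OF that(2,3)])
  qed simp_all
  show "summable (\<lambda>k. \<bar>Im (\<mu> k)\<bar> powr (3 + \<tau>) / cmod (\<mu> k + 2))"
    by (rule Im_summable) simp
  show "summable (\<lambda>k. \<bar>Im (\<mu> k)\<bar> powr (3 + \<tau>) / cmod (\<mu> k - 2))"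
    using Im_summable[of "-2"] by simp
  \<comment> \<open>The weighted sum at the endpoint -2 dominates this one, because |\<mu>_k + 2| is
    bounded by M + 2.\<close>
  show "summable (\<lambda>k. \<bar>Im (\<mu> k)\<bar> powr (3 + \<tau>))"
  proof (rule summable_comparison_test'[where N = 0])
    show "summable (\<lambda>k. (M + 2) * (\<bar>Im (\<mu> k)\<bar> powr (3 + \<tau>) / cmod (\<mu> k + 2)))"
      by (intro summable_mult Im_summable) simp
    show "norm (\<bar>Im (\<mu> k)\<bar> powr (3 + \<tau>)) \<le> (M + 2) * (\<bar>Im (\<mu> k)\<bar> powr (3 + \<tau>) / cmod (\<mu> k + 2))" for k
    proof (cases "\<mu> k + 2 = 0")
      case True
      then have "Im (\<mu> k + 2) = 0" by simp
      then have "Im (\<mu> k) = 0" by simp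
      then show ?thesis by simp
    next
      case False
      then have pos: "0 < cmod (\<mu> k + 2)" by simp
      have "cmod (\<mu> k + 2) \<le> M + 2" using norm_triangle_ineq[of "\<mu> k" 2] M[of k] by simp
      then have "cmod (\<mu> k + 2) * (\<bar>Im (\<mu> k)\<bar> powr (3 + \<tau>) / cmod (\<mu> k + 2)) \<le>
          (M + 2) * (\<bar>Im (\<mu> k)\<bar> powr (3 + \<tau>) / cmod (\<mu> k + 2))"
        by (rule mult_right_mono) simp
      then show ?thesis using False by simp
    qed
  qed
  have power_split: "x powr (3 + \<tau>) / x = x powr (2 + \<tau>)" if "0 \<le> x" for x :: real
  proof (cases "x = 0")
    case False
    have "3 + \<tau> = (2 + \<tau>) + 1" by simp
    then have "x powr (3 + \<tau>) = x powr (2 + \<tau>) * x powr 1"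
      by (simp only: powr_add)
    then show ?thesis using False that by simp
  qed simp
  show "summable (\<lambda>k. cmod (\<mu> k + 2) powr (2 + \<tau>))" if "case_ia l \<mu>"
  proof -
    have Re: "Re (\<mu> k) \<le> -2" for k using that unfolding case_ia_def by blast
    \<comment> \<open>Choosing \<open>Y k\<close> as the distance to -2, the division lowers the
      exponent from 3 + \<tau> to 2 + \<tau>.\<close>
    have "summable (\<lambda>k. cmod (\<mu> k + 2) powr (3 + \<tau>) / cmod (\<mu> k + 2))"
    proof (rule *[OF \<tau>])
      show "cmod (\<mu> k + 2) * (cmod w)\<^sup>2 \<le> (1 - (cmod w)\<^sup>2) * cmod (1 - w\<^sup>2)"
        if w: "\<mu> k = w + 1 / w" "w \<noteq> 0" "cmod w < 1" for k w
      proof -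
        have "cmod (\<mu> k + 2) * (cmod w)\<^sup>2 \<le> cmod (\<mu> k + 2) * cmod w"
          using w(3) by (intro mult_left_mono) (simp_all add: power2_eq_square mult_left_le)
        also have "\<dots> \<le> (1 - (cmod w)\<^sup>2) * cmod (1 - w\<^sup>2)"
          using Re[of k] unfolding w(1) by (rule dist_joukowski_le[OF w(2,3)])
        finally show ?thesis .
      qed
      show "cmod (\<mu> k + 2) = 0" if "Im (\<mu> k) = 0" "\<bar>Re (\<mu> k)\<bar> \<le> 2" for k
        using that Re[of k] by (simp add: complex_eq_iff)
    qed simp_all
    then show ?thesis by (simp only: power_split norm_ge_zero)
  qed
  show "summable (\<lambda>k. cmod (\<mu> k - 2) powr (2 + \<tau>))" if "case_ib l \<mu>"
  proof -
    have Re: "2 \<le> Re (\<mu> k)" for k using that unfolding case_ib_def by blast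
    have "summable (\<lambda>k. cmod (\<mu> k - 2) powr (3 + \<tau>) / cmod (\<mu> k + -2))"
    proof (rule *[OF \<tau>])
      show "cmod (\<mu> k - 2) * (cmod w)\<^sup>2 \<le> (1 - (cmod w)\<^sup>2) * cmod (1 - w\<^sup>2)"
        if w: "\<mu> k = w + 1 / w" "w \<noteq> 0" "cmod w < 1" for k w
      proof -
        \<comment> \<open>The reflection w to -w turns the endpoint 2 into -2 and leaves |w| and w^2
          unchanged.\<close>
        have neg: "- w + 1 / - w + 2 = - (\<mu> k - 2)" by (simp add: w(1))
        have "Re (- w + 1 / - w) = - Re (\<mu> k)" by (simp add: w(1))
        then have "Re (- w + 1 / - w) \<le> - 2" using Re[of k] by simp
        from dist_joukowski_le[OF _ _ this] w(2,3)
        have "cmod (\<mu> k - 2) * cmod w \<le> (1 - (cmod w)\<^sup>2) * cmod (1 - w\<^sup>2)"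
          unfolding neg by (simp add: norm_minus_commute)
        moreover have "cmod (\<mu> k - 2) * (cmod w)\<^sup>2 \<le> cmod (\<mu> k - 2) * cmod w"
          using w(3) by (intro mult_left_mono) (simp_all add: power2_eq_square mult_left_le)
        ultimately show ?thesis by linarith
      qed
      show "cmod (\<mu> k - 2) = 0" if "Im (\<mu> k) = 0" "\<bar>Re (\<mu> k)\<bar> \<le> 2" for k
        using that Re[of k] by (simp add: complex_eq_iff)
    qed simp_all
    then have "summable (\<lambda>k. cmod (\<mu> k - 2) powr (3 + \<tau>) / cmod (\<mu> k - 2))" by simp
    then show ?thesis by (simp only: power_split norm_ge_zero)
  qed
qed

end
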